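(* (Stability and positivity for $d=3$.) Let $\{I^k_{i,j,l,m,n}\}$ be defined by the three-dimensional upwind scheme (S3) described in the context. Suppose that the discretization parameters satisfy $$\frac{c^+\Delta t}{\Delta x_1}+\frac{c^+\Delta t}{\Delta x_2}+\frac{c^+\Delta t}{\Delta x_3}\le1$$ and $$\Delta\theta^2\,\sup\left|\frac{\partial^2}{\partial\theta^2}\Bigl[p\bigl(x;\xi,\xi'(\theta,\phi)\bigr)\sin\theta\Bigr]\right|+\frac{\Delta\phi^2}{2}\,\sup\left|\frac{\partial^2}{\partial\phi^2}\Bigl[p\bigl(x;\xi,\xi'(\theta,\phi)\bigr)\sin\theta\Bigr]\right|\le\frac{6}{\pi^2}\mu^*,$$ where $\xi'(\theta,\phi)=(\sin\theta\cos\phi,\sin\theta\sin\phi,\cos\theta)$ and the suprema are taken over $(x,\xi)\in X$, $0\le\theta\le\pi$, $0\le\phi\le2\pi$. Then $$\|I^k\|_\infty\le\|I_0\|_\infty+\|I_1\|_\infty+c^+\|q\|_\infty T,\qquad 0\le k\le T/\Delta t,$$ where $\|I^k\|_\infty:=\sup\{|I^k_{i,j,l,m,n}|:\ (x_{ijl},\xi_{mn})\in X\cup\Gamma_-\}$. Moreover, if $q\ge0$, $I_0\ge0$ and $I_1\ge0$, then $I^k_{i,j,l,m,n}\ge0$ for all $k,i,j,l,m,n$.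
   Context: Domain and data. Let $T>0$, $\Omega=(0,L_1)\times(0,L_2)\times(0,L_3)\subset\mathbb{R}^3$, $X=\Omega\times S^2$, and $\Gamma_-=\{(x,\xi)\in\partial\Omega\times S^2:\ n(x)\cdot\xi<0\}$, where $n(x)$ is the outward unit normal at $x\in\partial\Omega$ (undefined on the edges and corners of the box, which are not part of $\Gamma_-$ and do not enter the scheme). The functions $c,\mu_{\rm a},\mu_{\rm s}$ on $\Omega$ are measurable with $c(x)>0$, $\mu_{\rm a}(x)\ge0$, $\mu_{\rm s}(x)\ge0$, $\mu_{\rm s}\not\equiv0$, and $$c^+:=\sup_{x\in\Omega}c(x)<\infty,\qquad \mu^*:=\inf_{\{x:\ \mu_{\rm s}(x)\ne0\}}\frac{\mu_{\rm a}(x)}{\mu_{\rm s}(x)}>0.$$ The scattering kernel is $p(x;\xi,\xi')=\tilde p(x;\alpha)$, where $\alpha$ is the angle formed by $\xi,\xi'\in S^2$, and $\tilde p(x;\alpha)\ge0$ is, for each $x\in\Omega$, $2\pi$-periodic, even and of class $C^2$ in $\alpha$, with $2\pi\int_0^{\pi}\tilde p(x;\alpha)\sin\alpha\,d\alpha=1$ (equivalently $\int_{S^2}p(x;\xi,\xi')\,d\omega_{\xi'}=1$ for all $x\in\Omega$, $\xi\in S^2$, with $d\omega$ the surface element) and $\sup_{(x,\alpha)\in\Omega\times[0,2\pi]}|\partial^2\tilde p/\partial\alpha^2(x;\alpha)|<\infty$. The inputs $q(t,x,\xi)$ (for $(x,\xi)\in X$), $I_0(x,\xi)$ (for $(x,\xi)\in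 X$) and $I_1(t,x,\xi)$ (for $(x,\xi)\in\Gamma_-$) are real bounded measurable functions, with $t\in[0,T]$; $\|q\|_\infty,\|I_0\|_\infty,\|I_1\|_\infty$ denote their sup norms. Grid. For positive integers $M_1,M_2,M_3,M_\theta,M_\phi$ and $\Delta t>0$ put $\Delta x_i=L_i/M_i$ $(i=1,2,3)$, $\Delta\theta=\pi/M_\theta$, $\Delta\phi=2\pi/M_\phi$, $t_k=k\Delta t$, $x_{ijl}=(i\Delta x_1,j\Delta x_2,l\Delta x_3)$, $\theta_m=m\Delta\theta$, $\phi_n=n\Delta\phi$, $\xi_{mn}=(\xi_{mn,1},\xi_{mn,2},\xi_{mn,3})=(\sin\theta_m\cos\phi_n,\sin\theta_m\sin\phi_n,\cos\theta_m)$ for integers $k,i,j,l,m,n$. Scheme (S3). The numbers $I^k_{i,j,l,m,n}$ are determined by $$\frac{1}{c(x_{ijl})}\frac{I^{k+1}_{i,j,l,m,n}-I^k_{i,j,l,m,n}}{\Delta t}=A_\Delta I^k_{i,j,l,m,n}-\Sigma_\Delta I^{k+1}_{i,j,l,m,n}+K_\Delta I^k_{i,j,l,m,n}+q(t_k,x_{ijl},\xi_{mn}),\quad 0\le k\le T/\Delta t-1,\ (x_{ijl},\xi_{mn})\in X,$$ $$I^0_{i,j,l,m,n}=I_0(x_{ijl},\xi_{mn}),\ (x_{ijl},\xi_{mn})\in X;\qquad I^k_{i,j,l,m,n}=I_1(t_k,x_{ijl},\xi_{mn}),\ 0\le k\le T/\Delta t,\ (x_{ijl},\xi_{mn})\in\Gamma_-,$$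 where $$\begin{aligned}A_\Delta I^k_{i,j,l,m,n}={}&-\xi_{mn,1}\frac{I^k_{i+1,j,l,m,n}-I^k_{i-1,j,l,m,n}}{2\Delta x_1}+|\xi_{mn,1}|\frac{I^k_{i+1,j,l,m,n}-2I^k_{i,j,l,m,n}+I^k_{i-1,j,l,m,n}}{2\Delta x_1}\\&-\xi_{mn,2}\frac{I^k_{i,j+1,l,m,n}-I^k_{i,j-1,l,m,n}}{2\Delta x_2}+|\xi_{mn,2}|\frac{I^k_{i,j+1,l,m,n}-2I^k_{i,j,l,m,n}+I^k_{i,j-1,l,m,n}}{2\Delta x_2}\\&-\xi_{mn,3}\frac{I^k_{i,j,l+1,m,n}-I^k_{i,j,l-1,m,n}}{2\Delta x_3}+|\xi_{mn,3}|\frac{I^k_{i,j,l+1,m,n}-2I^k_{i,j,l,m,n}+I^k_{i,j,l-1,m,n}}{2\Delta x_3},\end{aligned}$$ $$\Sigma_\Delta I^k_{i,j,l,m,n}=\{\mu_{\rm s}(x_{ijl})+\mu_{\rm a}(x_{ijl})\}I^k_{i,j,l,m,n},$$ $$K_\Delta I^k_{i,j,l,m,n}=\mu_{\rm s}(x_{ijl})\Delta\theta\Delta\phi\sum_{\mu=1}^{M_\theta-1}\sum_{\nu=0}^{M_\phi-1}p(x_{ijl};\xi_{mn},\xi_{\mu\nu})\sin\theta_\mu\,I^k_{i,j,l,\mu,\nu}.$$ In $A_\Delta$, values at grid points outside $X\cup\Gamma_-$ occur only with total coefficient $0$ and are disregarded. *)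

theory Defs
  imports "HOL-Analysis.Analysis"
begin

(* Valued in ennreal, so that an empty supremum is 0 and an unbounded one is infinite. *)
definition sup_norm :: "'a set \<Rightarrow> ('a \<Rightarrow> real) \<Rightarrow> ennreal" where
  "sup_norm S f = (SUP z\<in>S. ennreal \<bar>f z\<bar>)"

abbreviation S2 :: "(real^3) set" where
  "S2 \<equiv> sphere 0 1"

definition sph :: "real \<Rightarrow> real \<Rightarrow> real^3" where
  "sph \<theta> \<phi> = vector [sin \<theta> * cos \<phi>, sin \<theta> * sin \<phi>, cos \<theta>]"

(* Only the relative interiors of the six faces carry a normal; edges and corners have none. *)
definition outward_unit_normal :: "real^3 \<Rightarrow> real^3 \<Rightarrow> real^3 \<Rightarrow> bool" where
  "outward_unit_normal L x n \<longleftrightarrow>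
    (\<exists>a. (\<forall>b. b \<noteq> a \<longrightarrow> 0 < x $ b \<and> x $ b < L $ b) \<and>
         (x $ a = 0 \<and> n = - axis a 1 \<or> x $ a = L $ a \<and> n = axis a 1))"

definition phase_space :: "real^3 \<Rightarrow> ((real^3) \<times> (real^3)) set" where
  "phase_space L = box 0 L \<times> S2"

definition inflow_boundary :: "real^3 \<Rightarrow> ((real^3) \<times> (real^3)) set" where
  "inflow_boundary L =
    {(x, \<xi>). x \<in> frontier (box 0 L) \<and> \<xi> \<in> S2 \<and> (\<exists>n. outward_unit_normal L x n \<and> n \<bullet> \<xi> < 0)}"

(* Lebesgue measurability on the sphere, or on the faces of the box, is expressed by extending
   the function constantly along the normal direction to a set of full dimension:
   sgn y is y / norm y, and replacing coordinate a of x by s projects the box onto a face. *)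

definition measurable_source :: "real \<Rightarrow> real^3 \<Rightarrow> (real \<times> (real^3) \<times> (real^3) \<Rightarrow> real) \<Rightarrow> bool" where
  "measurable_source T L q \<longleftrightarrow>
    (\<lambda>(t, x, y). q (t, x, sgn y)) \<in> borel_measurable (lebesgue_on ({0..T} \<times> box 0 L \<times> - {0}))"

definition measurable_initial :: "real^3 \<Rightarrow> ((real^3) \<times> (real^3) \<Rightarrow> real) \<Rightarrow> bool" where
  "measurable_initial L f \<longleftrightarrow>
    (\<lambda>(x, y). f (x, sgn y)) \<in> borel_measurable (lebesgue_on (box 0 L \<times> - {0}))"

definition measurable_inflow :: "real \<Rightarrow> real^3 \<Rightarrow> (real \<times> (real^3) \<times> (real^3) \<Rightarrow> real) \<Rightarrow> bool" where
  "measurable_inflow T L g \<longleftrightarrow>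
    (\<forall>a. \<forall>s\<in>{0, L $ a}. let proj = (\<lambda>x. (\<chi> b. if b = a then s else x $ b)) in
      (\<lambda>(t, x, y). g (t, proj x, sgn y)) \<in> borel_measurable (lebesgue_on
        {(t, x, y). t \<in> {0..T} \<and> x \<in> box 0 L \<and> y \<noteq> 0 \<and> (proj x, sgn y) \<in> inflow_boundary L}))"

definition C2_function :: "(real \<Rightarrow> real) \<Rightarrow> bool" where
  "C2_function f \<longleftrightarrow> (\<forall>\<alpha>. f differentiable at \<alpha>) \<and> deriv f C1_differentiable_on UNIV"

definition scattering_kernel ::
    "(real^3 \<Rightarrow> real \<Rightarrow> real) \<Rightarrow> real^3 \<Rightarrow> real^3 \<Rightarrow> real^3 \<Rightarrow> real" where
  "scattering_kernel pt x \<xi> \<xi>' = pt x (arccos (\<xi> \<bullet> \<xi>'))"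

definition sup_dtheta2 :: "real^3 \<Rightarrow> (real^3 \<Rightarrow> real \<Rightarrow> real) \<Rightarrow> ennreal" where
  "sup_dtheta2 L pt =
    sup_norm (phase_space L \<times> {0..pi} \<times> {0..2*pi})
      (\<lambda>((x, \<xi>), \<theta>, \<phi>). (deriv ^^ 2) (\<lambda>\<theta>. scattering_kernel pt x \<xi> (sph \<theta> \<phi>) * sin \<theta>) \<theta>)"

definition sup_dphi2 :: "real^3 \<Rightarrow> (real^3 \<Rightarrow> real \<Rightarrow> real) \<Rightarrow> ennreal" where
  "sup_dphi2 L pt =
    sup_norm (phase_space L \<times> {0..pi} \<times> {0..2*pi})
      (\<lambda>((x, \<xi>), \<theta>, \<phi>). (deriv ^^ 2) (\<lambda>\<phi>. scattering_kernel pt x \<xi> (sph \<theta> \<phi>) * sin \<theta>) \<phi>)"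

definition grid_point :: "real^3 \<Rightarrow> int^3 \<Rightarrow> real^3" where
  "grid_point \<Delta>x i = (\<chi> a. real_of_int (i $ a) * \<Delta>x $ a)"

definition grid_direction :: "real \<Rightarrow> real \<Rightarrow> int \<Rightarrow> int \<Rightarrow> real^3" where
  "grid_direction \<Delta>\<theta> \<Delta>\<phi> m n = sph (real_of_int m * \<Delta>\<theta>) (real_of_int n * \<Delta>\<phi>)"

(* The difference operators act on one time level; u i m n stands for the unknown with the
   spatial multi-index i = (i, j, l), and axis a 1 is the shift by one in direction a. *)

definition A_\<Delta> :: "real^3 \<Rightarrow> real \<Rightarrow> real \<Rightarrow> (int^3 \<Rightarrow> int \<Rightarrow> int \<Rightarrow> real) \<Rightarrow> int^3 \<Rightarrow> int \<Rightarrow> int \<Rightarrow> real" where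
  "A_\<Delta> \<Delta>x \<Delta>\<theta> \<Delta>\<phi> u i m n =
    (\<Sum>a\<in>UNIV.
      - (grid_direction \<Delta>\<theta> \<Delta>\<phi> m n $ a) *
          ((u (i + axis a 1) m n - u (i - axis a 1) m n) / (2 * \<Delta>x $ a))
      + \<bar>grid_direction \<Delta>\<theta> \<Delta>\<phi> m n $ a\<bar> *
          ((u (i + axis a 1) m n - 2 * u i m n + u (i - axis a 1) m n) / (2 * \<Delta>x $ a)))"

definition \<Sigma>_\<Delta> :: "real^3 \<Rightarrow> (real^3 \<Rightarrow> real) \<Rightarrow> (real^3 \<Rightarrow> real) \<Rightarrow>
    (int^3 \<Rightarrow> int \<Rightarrow> int \<Rightarrow> real) \<Rightarrow> int^3 \<Rightarrow> int \<Rightarrow> int \<Rightarrow> real" where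
  "\<Sigma>_\<Delta> \<Delta>x \<mu>a \<mu>s u i m n = (\<mu>s (grid_point \<Delta>x i) + \<mu>a (grid_point \<Delta>x i)) * u i m n"

definition K_\<Delta> :: "real^3 \<Rightarrow> nat \<Rightarrow> nat \<Rightarrow> real \<Rightarrow> real \<Rightarrow> (real^3 \<Rightarrow> real) \<Rightarrow> (real^3 \<Rightarrow> real \<Rightarrow> real) \<Rightarrow>
    (int^3 \<Rightarrow> int \<Rightarrow> int \<Rightarrow> real) \<Rightarrow> int^3 \<Rightarrow> int \<Rightarrow> int \<Rightarrow> real" where
  "K_\<Delta> \<Delta>x M\<theta> M\<phi> \<Delta>\<theta> \<Delta>\<phi> \<mu>s pt u i m n =
    \<mu>s (grid_point \<Delta>x i) * \<Delta>\<theta> * \<Delta>\<phi> *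
    (\<Sum>\<mu>\<in>{1..int M\<theta> - 1}. \<Sum>\<nu>\<in>{0..int M\<phi> - 1}.
      scattering_kernel pt (grid_point \<Delta>x i)
        (grid_direction \<Delta>\<theta> \<Delta>\<phi> m n) (grid_direction \<Delta>\<theta> \<Delta>\<phi> \<mu> \<nu>) *
      sin (real_of_int \<mu> * \<Delta>\<theta>) * u i \<mu> \<nu>)"

definition grid_in :: "real^3 \<Rightarrow> real \<Rightarrow> real \<Rightarrow> ((real^3) \<times> (real^3)) set \<Rightarrow> ((int^3) \<times> int \<times> int) set" where
  "grid_in \<Delta>x \<Delta>\<theta> \<Delta>\<phi> S = {(i, m, n). (grid_point \<Delta>x i, grid_direction \<Delta>\<theta> \<Delta>\<phi> m n) \<in> S}"

end

theory Submission
  imports Defs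
begin

text \<open>One step of the scheme expresses \<open>(1 + c \<Delta>t (\<mu>s + \<mu>a)) I\<^sup>k\<^sup>+\<^sup>1\<close> through the old values: under the CFL
  condition transport is a convex combination of a value and its three upwind neighbours, and
  scattering contributes \<open>c \<Delta>t \<mu>s W\<close> times a weighted mean, \<open>W\<close> being the quadrature sum of the kernel. If
  \<open>W \<le> 1 + \<mu>*\<close>, then \<open>\<mu>s W \<le> \<mu>s + \<mu>a\<close>, so each step raises the maximum by at most
  \<open>c \<Delta>t \<parallel>q\<parallel>\<close> and preserves nonnegativity.

  The bound on \<open>W\<close> is an error estimate for the product trapezoidal rule applied to an integral equal
  to \<open>1\<close>, which is where rotation invariance on the sphere enters. In \<open>\<theta>\<close> the factor \<open>sin \<theta>\<close> makes the
  missing end nodes irrelevant; in \<open>\<phi>\<close> periodicity halves the usual error constant.\<close>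

section \<open>The trapezoidal rule\<close>

text \<open>The constant \<open>6 / pi^2\<close> is dictated by the error count: a
  \<open>\<theta>\<close> error \<open>pi * \<Delta>\<theta>^2 * A / 12\<close> accumulated over the
  length \<open>2 * pi\<close> and a \<open>\<phi>\<close> error
  \<open>2 * pi * \<Delta>\<phi>^2 * B / 24\<close> accumulated over the length \<open>pi\<close>
  add up to \<open>pi^2 / 6 * (\<Delta>\<theta>^2 * A + \<Delta>\<phi>^2 / 2 * B)\<close>. The
  angular hypothesis speaks of \<open>deriv ^^ 2\<close>, which has some value even where no
  derivative exists. It says something about the kernel only once the kernel is known to be twice
  differentiable along every coordinate line. The kernel is \<open>pt x\<close> after
  \<open>arccos\<close>, which is singular exactly where such a line meets the direction
  \<open>\<xi>\<close> or its antipode. Evenness and periodicity of \<open>pt x\<close> remove the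
  singularity: the angle may be replaced by any twice differentiable function with the same
  cosine.\<close>

lemma trapezoid_cell:
  fixes f f' f'' e E :: "real \<Rightarrow> real" and a h c B :: real
  assumes h: "0 \<le> h"
    and f: "\<And>x. x \<in> {a..a + h} \<Longrightarrow> (f has_real_derivative f' x) (at x)"
    and f': "\<And>x. x \<in> {a..a + h} \<Longrightarrow> (f' has_real_derivative f'' x) (at x)"
    and B: "\<And>x. x \<in> {a..a + h} \<Longrightarrow> \<bar>f'' x\<bar> \<le> B"
    and E: "\<And>y. y \<in> {0..h} \<Longrightarrow> (E has_real_derivative e y) (at y)"
    and e: "\<And>y. y \<in> {0..h} \<Longrightarrow> \<bar>y * (h - y) / 2 - c\<bar> \<le> e y"
  shows "\<bar>h / 2 * (f a + f (a + h)) - integral {a..a + h} f - c * (f' (a + h) - f' a)\<bar>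
          \<le> B * (E h - E 0)"
proof -
  \<comment> \<open>The Peano kernel, shifted by \<open>c\<close>. Since \<open>K'' = -1\<close>,
    the function \<open>f' * K - f * K'\<close> is an antiderivative of \<open>f'' * K + f\<close>;
    its boundary values are the trapezoid and the correction with \<open>c\<close>. The fundamental
    theorem for the gauge integral also yields integrability, even for a discontinuous
    \<open>f''\<close>.\<close>
  define K where "K x = (x - a) * (h - (x - a)) / 2 - c" for x
  have F: "((\<lambda>x. f'' x * K x + f x) has_integral
      (f' (a + h) * K (a + h) - f (a + h) * (h / 2 - h)) - (f' a * K a - f a * (h / 2 - 0))) {a..a + h}"
  proof -
    have "((\<lambda>x. f'' x * K x + f x) has_integral
       (\<lambda>x. f' x * K x - f x * (h / 2 - (x - a))) (a + h) - (\<lambda>x. f' x * K x - f x * (h / 2 - (x - a))) a) {a..a + h}"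
    proof (rule fundamental_theorem_of_calculus)
      fix x assume x: "x \<in> {a..a + h}"
      have "((\<lambda>x. f' x * K x - f x * (h / 2 - (x - a))) has_real_derivative f'' x * K x + f x) (at x)"
        unfolding K_def
        by (rule derivative_eq_intros f[OF x] f'[OF x] refl | simp add: field_simps)+
      then show "((\<lambda>x. f' x * K x - f x * (h / 2 - (x - a))) has_vector_derivative f'' x * K x + f x) (at x within {a..a + h})"
        unfolding has_real_derivative_iff_has_vector_derivative
        by (rule has_vector_derivative_at_within)
    qed (use h in simp)
    then show ?thesis by simp
  qed
  have cont: "continuous_on {a..a + h} f"
    using f by (meson DERIV_isCont continuous_at_imp_continuous_on)
  then have fi: "(f has_integral integral {a..a + h} f) {a..a + h}"
    by (meson integrable_continuous_real integrable_integral)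
  have FK: "((\<lambda>x. f'' x * K x) has_integral
     h / 2 * (f a + f (a + h)) - integral {a..a + h} f - c * (f' (a + h) - f' a)) {a..a + h}"
    using has_integral_diff[OF F fi] by (simp add: K_def algebra_simps add_divide_distrib)
  \<comment> \<open>A majorant with explicit antiderivative stands in for the absolute kernel, which
    for \<open>c = h^2 / 12\<close> changes sign inside the cell.\<close>
  have Ei: "((\<lambda>x. B * e (x - a)) has_integral B * (E h - E 0)) {a..a + h}"
  proof -
    have "((\<lambda>x. e (x - a)) has_integral E (a + h - a) - E (a - a)) {a..a + h}"
    proof (rule fundamental_theorem_of_calculus)
      fix x assume x: "x \<in> {a..a + h}"
      then have y: "x - a \<in> {0..h}" by auto
      have "((\<lambda>x. E (x - a)) has_real_derivative e (x - a) * 1) (at x)"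
        by (rule DERIV_chain2[where g = "\<lambda>x. x - a", OF E[OF y]]) (auto intro!: derivative_eq_intros)
      then show "((\<lambda>x. E (x - a)) has_vector_derivative e (x - a)) (at x within {a..a + h})"
        unfolding mult_1_right has_real_derivative_iff_has_vector_derivative
        by (rule has_vector_derivative_at_within)
    qed (use h in simp)
    from has_integral_mult_right[OF this, of B] show ?thesis by simp
  qed
  have "norm (integral {a..a + h} (\<lambda>x. f'' x * K x)) \<le> integral {a..a + h} (\<lambda>x. B * e (x - a))"
  proof (rule integral_norm_bound_integral)
    fix x assume x: "x \<in> {a..a + h}"
    have "\<bar>K x\<bar> \<le> e (x - a)" using e[of "x - a"] x unfolding K_def by auto
    then show "norm (f'' x * K x) \<le> B * e (x - a)"
      using B[OF x] by (simp add: abs_mult mult_mono')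
  qed (use FK Ei in blast)+
  then show ?thesis
    unfolding integral_unique[OF FK] integral_unique[OF Ei] by simp
qed

text \<open>The corrections are kept apart from the error \<open>C\<close> because they telescope:
  only \<open>c\<close> times the difference of \<open>f'\<close> at the two ends survives, and this
  vanishes for a periodic integrand.\<close>

lemma trapezoid_cells:
  fixes f f' :: "real \<Rightarrow> real"
  assumes h: "0 \<le> h"
    and cont: "continuous_on {a..a + real N * h} f"
    and cell: "\<And>j. j < N \<Longrightarrow>
      \<bar>h / 2 * (f (a + real j * h) + f (a + real (Suc j) * h))
        - integral {a + real j * h..a + real (Suc j) * h} f
        - c * (f' (a + real (Suc j) * h) - f' (a + real j * h))\<bar> \<le> C"
  shows "\<bar>h / 2 * (\<Sum>j<N. f (a + real j * h) + f (a + real (Suc j) * h))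
      - integral {a..a + real N * h} f - c * (f' (a + real N * h) - f' a)\<bar> \<le> real N * C"
  using cont cell
proof (induction N)
  case 0
  then show ?case by simp
next
  case (Suc N)
  have le: "a + real N * h \<le> a + real (Suc N) * h" "a \<le> a + real N * h"
    using h by (auto simp: algebra_simps)
  have "integral {a..a + real (Suc N) * h} f
      = integral {a..a + real N * h} f + integral {a + real N * h..a + real (Suc N) * h} f"
    using Henstock_Kurzweil_Integration.integral_combine[OF le(2) le(1)] Suc.prems(1)
      integrable_continuous_real by metis
  moreover have "continuous_on {a..a + real N * h} f"
    using Suc.prems(1) by (rule continuous_on_subset) (use le in auto)
  ultimately have int: "integral {a..a + real (Suc N) * h} f
      = integral {a..a + real N * h} f + integral {a + real N * h..a + real (Suc N) * h} f"
    and IH: "\<bar>h / 2 * (\<Sum>j<N. f (a + real j * h) + f (a + real (Suc j) * h))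
      - integral {a..a + real N * h} f - c * (f' (a + real N * h) - f' a)\<bar> \<le> real N * C"
    using Suc.IH Suc.prems(2) by auto
  let ?s = "\<Sum>j<N. f (a + real j * h) + f (a + real (Suc j) * h)"
  let ?t = "f (a + real N * h) + f (a + real (Suc N) * h)"
  have "h / 2 * (?s + ?t) - (integral {a..a + real N * h} f + integral {a + real N * h..a + real (Suc N) * h} f)
      - c * (f' (a + real (Suc N) * h) - f' a)
    = (h / 2 * ?s - integral {a..a + real N * h} f - c * (f' (a + real N * h) - f' a))
      + (h / 2 * ?t - integral {a + real N * h..a + real (Suc N) * h} f
        - c * (f' (a + real (Suc N) * h) - f' (a + real N * h)))"
    unfolding distrib_left right_diff_distrib by simp
  then show ?case
    unfolding int sum.lessThan_Suc
    using order_trans[OF abs_triangle_ineq add_mono[OF IH Suc.prems(2)[of N]]]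
    by (simp only: of_nat_Suc distrib_right mult_1 add.commute[of 1])
qed

text \<open>Completing the square, with equality at \<open>\<bar>k\<bar> = h^2 / 24\<close>. It
  majorizes a sign-changing kernel by a polynomial at the price of a slightly worse
  constant.\<close>

lemma peano_kernel_shifted_bound:
  fixes h k :: real
  assumes "h > 0"
  shows "\<bar>k\<bar> \<le> 12 * k\<^sup>2 / h\<^sup>2 + h\<^sup>2 / 48"
proof -
  have "12 * k\<^sup>2 / h\<^sup>2 + h\<^sup>2 / 48 - \<bar>k\<bar> = 12 * (\<bar>k\<bar> - h\<^sup>2 / 24)\<^sup>2 / h\<^sup>2"
    using assms by (simp add: power2_diff) (simp add: field_simps)
  also have "\<dots> \<ge> 0" by simp
  finally show ?thesis by simp
qed

text \<open>Both bounds come from the Peano kernel \<open>y (h - y) / 2 - c\<close>, with \<open>c = 0\<close> and \<open>c = h\<^sup>2 / 12\<close>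
  respectively: in the periodic case the shift costs nothing, because \<open>f''\<close> has mean zero, and it
  gains the factor 2 that the weight \<open>\<Delta>\<phi>\<^sup>2 / 2\<close> in the angular hypothesis requires.\<close>

lemma trapezoid_rule:
  fixes f f' f'' :: "real \<Rightarrow> real"
  assumes N: "N > 0" and ab: "a < b" and h: "h = (b - a) / real N"
    and f: "\<And>x. x \<in> {a..b} \<Longrightarrow> (f has_real_derivative f' x) (at x)"
    and f': "\<And>x. x \<in> {a..b} \<Longrightarrow> (f' has_real_derivative f'' x) (at x)"
    and B: "\<And>x. x \<in> {a..b} \<Longrightarrow> \<bar>f'' x\<bar> \<le> B"
  shows "\<bar>h / 2 * (\<Sum>j<N. f (a + real j * h) + f (a + real (Suc j) * h)) - integral {a..b} f\<bar>
      \<le> (b - a) * h\<^sup>2 / 12 * B" (is ?standard)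
    and "f' a = f' b \<Longrightarrow>
      \<bar>h / 2 * (\<Sum>j<N. f (a + real j * h) + f (a + real (Suc j) * h)) - integral {a..b} f\<bar>
      \<le> (b - a) * h\<^sup>2 / 24 * B" (is "_ \<Longrightarrow> ?periodic")
proof -
  have hp: "h > 0" and Nh: "real N * h = b - a" using N ab h by auto
  have cont: "continuous_on {a..a + real N * h} f"
    using DERIV_isCont[OF f] Nh by (auto intro!: continuous_at_imp_continuous_on)
  have B0: "B \<ge> 0" using B[of a] ab by auto
  have sub: "x \<in> {a..b}" if "j < N" "x \<in> {a + real j * h..a + real j * h + h}" for j x
  proof -
    have "real (Suc j) * h \<le> real N * h" using that hp by (intro mult_right_mono) auto
    then have "real j * h + h \<le> real N * h" by (simp add: algebra_simps)
    moreover have "0 \<le> real j * h" using hp by simp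
    ultimately show ?thesis using Nh that(2) unfolding atLeastAtMost_iff by linarith
  qed
  have Suc: "a + real (Suc j) * h = a + real j * h + h" for j by (simp add: algebra_simps)
  \<comment> \<open>An antiderivative of the unshifted kernel, which is nonnegative on the cell and
    hence its own majorant; \<open>E1 h = h^3 / 12\<close>.\<close>
  define E1 where "E1 y = h * y\<^sup>2 / 4 - y ^ 3 / 6" for y
  have "\<bar>h / 2 * (f (a + real j * h) + f (a + real (Suc j) * h))
        - integral {a + real j * h..a + real (Suc j) * h} f
        - 0 * (f' (a + real (Suc j) * h) - f' (a + real j * h))\<bar> \<le> B * (E1 h - E1 0)" if j: "j < N" for j
    unfolding Suc
  proof (rule trapezoid_cell[OF less_imp_le[OF hp] f[OF sub[OF j]] f'[OF sub[OF j]] B[OF sub[OF j]], where e = "\<lambda>y. y * (h - y) / 2"])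
    fix y assume y: "y \<in> {0..h}"
    show "(E1 has_real_derivative y * (h - y) / 2) (at y)"
      unfolding E1_def by (rule derivative_eq_intros refl | simp add: field_simps power2_eq_square)+
    show "\<bar>y * (h - y) / 2 - 0\<bar> \<le> y * (h - y) / 2" using y by auto
  qed
  note trapezoid_cells[where f = f and f' = f' and c = 0, OF less_imp_le[OF hp] cont this]
  then have "\<bar>h / 2 * (\<Sum>j<N. f (a + real j * h) + f (a + real (Suc j) * h)) - integral {a..b} f\<bar>
     \<le> real N * (B * (E1 h - E1 0))" unfolding Nh by simp
  also have "\<dots> = (real N * h) * h\<^sup>2 / 12 * B"
    by (simp add: E1_def power2_eq_square power3_eq_cube field_simps)
  finally show ?standard using Nh by simp
  \<comment> \<open>The shift \<open>h^2 / 12\<close> is the mean of \<open>y * (h - y) / 2\<close>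
    over the cell. \<open>P\<close> is an antiderivative of the squared shifted kernel, with total
    \<open>h^5 / 720\<close>, and \<open>E2\<close> one of its quadratic majorant.\<close>
  define P where "P y = (h\<^sup>2 * y ^ 3 / 3 - h * y ^ 4 / 2 + y ^ 5 / 5) / 4
     - h\<^sup>2 * (h * y\<^sup>2 / 2 - y ^ 3 / 3) / 12 + h ^ 4 * y / 144" for y
  define E2 where "E2 y = 12 / h\<^sup>2 * P y + h\<^sup>2 / 48 * y" for y
  have P: "(P has_real_derivative (y * (h - y) / 2 - h\<^sup>2 / 12)\<^sup>2) (at y)" for y
    unfolding P_def
    by (auto intro!: derivative_eq_intros)
      (simp add: power2_eq_square power3_eq_cube power4_eq_xxxx field_simps)
  have "\<bar>h / 2 * (f (a + real j * h) + f (a + real (Suc j) * h))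
        - integral {a + real j * h..a + real (Suc j) * h} f
        - h\<^sup>2 / 12 * (f' (a + real (Suc j) * h) - f' (a + real j * h))\<bar> \<le> B * (E2 h - E2 0)" if j: "j < N" for j
    unfolding Suc
  proof (rule trapezoid_cell[OF less_imp_le[OF hp] f[OF sub[OF j]] f'[OF sub[OF j]] B[OF sub[OF j]], where E = E2 and c = "h\<^sup>2 / 12" and e = "\<lambda>y. 12 * (y * (h - y) / 2 - h\<^sup>2 / 12)\<^sup>2 / h\<^sup>2 + h\<^sup>2 / 48"])
    fix y assume y: "y \<in> {0..h}"
    have "(E2 has_real_derivative 12 / h\<^sup>2 * (y * (h - y) / 2 - h\<^sup>2 / 12)\<^sup>2 + h\<^sup>2 / 48 * 1) (at y)"
      unfolding E2_def by (intro DERIV_add DERIV_cmult P DERIV_ident)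
    then show "(E2 has_real_derivative 12 * (y * (h - y) / 2 - h\<^sup>2 / 12)\<^sup>2 / h\<^sup>2 + h\<^sup>2 / 48) (at y)"
      by simp
    show "\<bar>y * (h - y) / 2 - h\<^sup>2 / 12\<bar> \<le> 12 * (y * (h - y) / 2 - h\<^sup>2 / 12)\<^sup>2 / h\<^sup>2 + h\<^sup>2 / 48"
      by (rule peano_kernel_shifted_bound[OF hp])
  qed
  note trapezoid_cells[where f = f and f' = f' and c = "h\<^sup>2 / 12", OF less_imp_le[OF hp] cont this]
  then have per: "\<bar>h / 2 * (\<Sum>j<N. f (a + real j * h) + f (a + real (Suc j) * h)) - integral {a..b} f
     - h\<^sup>2 / 12 * (f' b - f' a)\<bar> \<le> real N * (B * (E2 h - E2 0))" unfolding Nh by simp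
  have Ph: "P h = h\<^sup>2 * (h ^ 3 / 720)"
    by (simp add: P_def eval_nat_numeral algebra_simps)
  have cancel: "12 / h\<^sup>2 * (h\<^sup>2 * X) = 12 * X" for X using hp by simp
  have "E2 h - E2 0 = 12 / h\<^sup>2 * P h + h\<^sup>2 / 48 * h"
    by (simp add: E2_def P_def)
  \<comment> \<open>\<open>12 / 720 + 1 / 48 = 3 / 80\<close> lies below the required
    \<open>1 / 24\<close>, so the loss in the majorant is affordable.\<close>
  also have "\<dots> = h ^ 3 * (3 / 80)"
    unfolding Ph cancel by (simp add: power2_eq_square power3_eq_cube)
  also have "\<dots> \<le> h ^ 3 / 24" using hp by simp
  finally have "real N * (B * (E2 h - E2 0)) \<le> real N * (B * (h ^ 3 / 24))"
    using B0 by (intro mult_left_mono) auto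
  also have "\<dots> = (real N * h) * h\<^sup>2 / 24 * B" by (simp add: power2_eq_square power3_eq_cube)
  finally have "real N * (B * (E2 h - E2 0)) \<le> (b - a) * h\<^sup>2 / 24 * B" unfolding Nh .
  from order_trans[OF per this] show ?periodic if "f' a = f' b" by (simp only: that diff_self mult_zero_right diff_0_right)
qed

text \<open>Equal end values merge into one node, which leaves the plain sum over left nodes used by
  the scattering operator.\<close>

lemma sum_trapezoid_eq:
  fixes u :: "nat \<Rightarrow> real"
  assumes "u 0 = u N"
  shows "(\<Sum>j<N. u j + u (Suc j)) = 2 * (\<Sum>j<N. u j)"
proof -
  have "(\<Sum>j<N. u (Suc j)) - (\<Sum>j<N. u j) = u N - u 0"
    unfolding sum_subtractf[symmetric] by (rule sum_lessThan_telescope)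
  then show ?thesis unfolding sum.distrib using assms by linarith
qed

section \<open>Rotation invariance on the sphere\<close>

lemma continuous_on_compose_real:
  fixes g :: "real \<Rightarrow> real"
  assumes "continuous_on {-1..1} g" "continuous_on S u" "\<And>z. z \<in> S \<Longrightarrow> \<bar>u z\<bar> \<le> 1"
  shows "continuous_on S (\<lambda>z. g (u z))"
  by (rule continuous_on_compose2[OF assms(1,2)]) (use assms(3) in \<open>force simp: abs_le_iff\<close>)

text \<open>Spherical law of cosines: the cosine of the angle between the directions with polar
  angle and azimuth \<open>(a, b)\<close> and \<open>(\<theta>, \<phi>)\<close>.\<close>

definition sphere_height :: "real \<Rightarrow> real \<Rightarrow> real \<Rightarrow> real \<Rightarrow> real" where
  "sphere_height a b \<theta> \<phi> = sin a * sin \<theta> * cos (\<phi> - b) + cos a * cos \<theta>"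

lemma inner_sph: "sph a b \<bullet> sph \<theta> \<phi> = sphere_height a b \<theta> \<phi>"
  by (simp add: sph_def sphere_height_def inner_vec_def sum_3 cos_diff algebra_simps)

lemma norm_sph: "norm (sph \<theta> \<phi>) = 1"
proof -
  have "sph \<theta> \<phi> \<bullet> sph \<theta> \<phi> = 1"
    by (simp add: inner_sph sphere_height_def sin_cos_squared_add[unfolded power2_eq_square])
  then show ?thesis by (simp add: norm_eq_1)
qed

lemma sphere_height_bound: "\<bar>sphere_height a b \<theta> \<phi>\<bar> \<le> 1"
  using Cauchy_Schwarz_ineq2[of "sph a b" "sph \<theta> \<phi>"] by (simp add: inner_sph norm_sph)

lemma continuous_on_sphere_height:
  fixes u v w :: "'z::t2_space \<Rightarrow> real"
  assumes "continuous_on S u" "continuous_on S v" "continuous_on S w"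
  shows "continuous_on S (\<lambda>z. sphere_height (u z) b (v z) (w z))"
  unfolding sphere_height_def by (intro continuous_intros assms)

text \<open>Surface integral of a function of the height along the axis \<open>sph a b\<close>, in
  polar coordinates. The angle \<open>a\<close> comes last so that
  \<open>sphere_integral b g\<close> is the function to be shown constant.\<close>

definition sphere_integral :: "real \<Rightarrow> (real \<Rightarrow> real) \<Rightarrow> real \<Rightarrow> real" where
  "sphere_integral b g a =
     integral (cbox (0, 0) (pi, 2 * pi)) (\<lambda>(\<theta>, \<phi>). g (sphere_height a b \<theta> \<phi>) * sin \<theta>)"

lemma sphere_integrand_integrable:
  assumes "continuous_on {-1..1} g"
  shows "(\<lambda>(\<theta>, \<phi>). g (sphere_height a b \<theta> \<phi>) * sin \<theta>) integrable_on cbox (0, 0) (pi, 2 * pi)"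
  unfolding case_prod_beta
  by (intro integrable_continuous continuous_intros continuous_on_compose_real[OF assms]
      continuous_on_sphere_height sphere_height_bound)

text \<open>Rotating the pole moves the integrand along a divergence-free field, so its derivative in
  the angle \<open>a\<close> is
  \<open>\<partial>\<^sub>\<phi> (cos \<theta> sin (\<phi> - b) g) - \<partial>\<^sub>\<theta> (sin \<theta> cos (\<phi> - b) g)\<close>; the first part integrates to \<open>0\<close>
  by periodicity, the second because \<open>sin \<theta>\<close> vanishes at both ends.\<close>

lemma sphere_integral_smooth_derivative:
  fixes g g' :: "real \<Rightarrow> real"
  assumes g: "\<And>x. (g has_real_derivative g' x) (at x)" and g': "continuous_on UNIV g'"
  shows "(sphere_integral b g has_real_derivative 0) (at a)"
proof -
  define s where "s = sphere_height"
  define sa where "sa a \<theta> \<phi> = cos a * sin \<theta> * cos (\<phi> - b) - sin a * cos \<theta>" for a \<theta> \<phi>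
  \<comment> \<open>\<open>F1\<close> and \<open>F2\<close> are the \<open>\<theta>\<close>- and
    \<open>\<phi>\<close>-derivatives of the two fluxes. Their terms without \<open>g'\<close>
    coincide, which expresses that the rotation field is divergence-free, and cancel in
    \<open>F2 - F1\<close>.\<close>
  define F1 where "F1 \<theta> \<phi> = g' (s a b \<theta> \<phi>) * (sin a * cos \<theta> * cos (\<phi> - b) - cos a * sin \<theta>)
      * (sin \<theta> * cos (\<phi> - b)) + g (s a b \<theta> \<phi>) * (cos \<theta> * cos (\<phi> - b))" for \<theta> \<phi>
  define F2 where "F2 \<theta> \<phi> = g' (s a b \<theta> \<phi>) * (- (sin a * sin \<theta> * sin (\<phi> - b)))
      * (cos \<theta> * sin (\<phi> - b)) + g (s a b \<theta> \<phi>) * (cos \<theta> * cos (\<phi> - b))" for \<theta> \<phi>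
  have gc: "continuous_on UNIV g" using g DERIV_continuous_on by blast
  have s_cont: "continuous_on S (\<lambda>z. s (u z) b (v z) (w z))"
    if "continuous_on S u" "continuous_on S v" "continuous_on S w" for S and u v w :: "'z::t2_space \<Rightarrow> real"
    using that unfolding s_def by (rule continuous_on_sphere_height)
  note comp = continuous_on_compose2[OF gc _ subset_UNIV] continuous_on_compose2[OF g' _ subset_UNIV]
  have deriv: "((\<lambda>a. integral (cbox (0, 0) (pi, 2 * pi)) (\<lambda>z. g (s a b (fst z) (snd z)) * sin (fst z)))
    has_real_derivative integral (cbox (0, 0) (pi, 2 * pi)) (\<lambda>z. g' (s a b (fst z) (snd z)) * sa a (fst z) (snd z) * sin (fst z)))
    (at a)"
  proof (rule leibniz_rule_field_derivative[where U = UNIV])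
    fix x :: real and t :: "real \<times> real"
    have "((\<lambda>a. s a b (fst t) (snd t)) has_real_derivative sa x (fst t) (snd t)) (at x)"
      unfolding s_def sphere_height_def sa_def by (auto intro!: derivative_eq_intros)
    from DERIV_chain2[OF g this]
    show "((\<lambda>x. g (s x b (fst t) (snd t)) * sin (fst t)) has_real_derivative
       g' (s x b (fst t) (snd t)) * sa x (fst t) (snd t) * sin (fst t)) (at x)"
      by (rule DERIV_cmult_right)
    show "(\<lambda>z. g (s x b (fst z) (snd z)) * sin (fst z)) integrable_on cbox (0, 0) (pi, 2 * pi)"
      by (intro integrable_continuous continuous_intros comp s_cont)
    show "continuous_on (UNIV \<times> cbox (0, 0) (pi, 2 * pi))
      (\<lambda>(x, z). g' (s x b (fst z) (snd z)) * sa x (fst z) (snd z) * sin (fst z))"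
      unfolding sa_def case_prod_beta by (intro continuous_intros comp s_cont)
  qed auto
  have c1: "continuous_on (cbox (0, 0) (pi, 2 * pi)) (\<lambda>(\<theta>, \<phi>). F1 \<theta> \<phi>)"
    unfolding F1_def case_prod_beta by (intro continuous_intros comp s_cont)
  have c2: "continuous_on (cbox (0, 0) (pi, 2 * pi)) (\<lambda>(\<theta>, \<phi>). F2 \<theta> \<phi>)"
    unfolding F2_def case_prod_beta by (intro continuous_intros comp s_cont)
  have eq: "g' (s a b \<theta> \<phi>) * sa a \<theta> \<phi> * sin \<theta> = F2 \<theta> \<phi> - F1 \<theta> \<phi>" for \<theta> \<phi>
  proof -
    have "sa a \<theta> \<phi> * sin \<theta> = - (sin a * sin \<theta> * sin (\<phi> - b)) * (cos \<theta> * sin (\<phi> - b))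
       - (sin a * cos \<theta> * cos (\<phi> - b) - cos a * sin \<theta>) * (sin \<theta> * cos (\<phi> - b))"
      using sin_cos_squared_add[of "\<phi> - b"] unfolding sa_def by algebra
    moreover have "F2 \<theta> \<phi> - F1 \<theta> \<phi> = g' (s a b \<theta> \<phi>) * (- (sin a * sin \<theta> * sin (\<phi> - b)) * (cos \<theta> * sin (\<phi> - b))
       - (sin a * cos \<theta> * cos (\<phi> - b) - cos a * sin \<theta>) * (sin \<theta> * cos (\<phi> - b)))"
      unfolding F1_def F2_def by (simp add: algebra_simps)
    ultimately show ?thesis by (simp only: mult.assoc)
  qed
  have I1: "integral (cbox (0, 0) (pi, 2 * pi)) (\<lambda>(\<theta>, \<phi>). F1 \<theta> \<phi>) = 0"
  proof -
    have "integral (cbox 0 pi) (\<lambda>\<theta>. F1 \<theta> \<phi>) = 0" for \<phi>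
    proof -
      have "((\<lambda>\<theta>. F1 \<theta> \<phi>) has_integral (\<lambda>\<theta>. g (s a b \<theta> \<phi>) * (sin \<theta> * cos (\<phi> - b))) pi
          - (\<lambda>\<theta>. g (s a b \<theta> \<phi>) * (sin \<theta> * cos (\<phi> - b))) 0) {0..pi}"
      proof (rule fundamental_theorem_of_calculus)
        fix \<theta> :: real
        have d: "((\<lambda>\<theta>. s a b \<theta> \<phi>) has_real_derivative (sin a * cos \<theta> * cos (\<phi> - b) - cos a * sin \<theta>)) (at \<theta>)"
          unfolding s_def sphere_height_def by (auto intro!: derivative_eq_intros)
        have e: "((\<lambda>\<theta>. sin \<theta> * cos (\<phi> - b)) has_real_derivative cos \<theta> * cos (\<phi> - b)) (at \<theta>)"
          by (auto intro!: derivative_eq_intros)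
        show "((\<lambda>\<theta>. g (s a b \<theta> \<phi>) * (sin \<theta> * cos (\<phi> - b))) has_vector_derivative F1 \<theta> \<phi>) (at \<theta> within {0..pi})"
          using DERIV_mult[OF DERIV_chain2[OF g d] e]
          by (simp add: F1_def has_real_derivative_iff_has_vector_derivative has_vector_derivative_at_within mult.commute)
      qed simp
      then show ?thesis by (simp add: integral_unique)
    qed
    then show ?thesis
      using integral_prod_continuous[OF c1] integral_swap_continuous[OF c1] by simp
  qed
  have I2: "integral (cbox (0, 0) (pi, 2 * pi)) (\<lambda>(\<theta>, \<phi>). F2 \<theta> \<phi>) = 0"
  proof -
    have "integral (cbox 0 (2 * pi)) (\<lambda>\<phi>. F2 \<theta> \<phi>) = 0" for \<theta>
    proof -
      have "((\<lambda>\<phi>. F2 \<theta> \<phi>) has_integral (\<lambda>\<phi>. g (s a b \<theta> \<phi>) * (cos \<theta> * sin (\<phi> - b))) (2 * pi)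
          - (\<lambda>\<phi>. g (s a b \<theta> \<phi>) * (cos \<theta> * sin (\<phi> - b))) 0) {0..2 * pi}"
      proof (rule fundamental_theorem_of_calculus)
        fix \<phi> :: real
        have d: "((\<lambda>\<phi>. s a b \<theta> \<phi>) has_real_derivative - (sin a * sin \<theta> * sin (\<phi> - b))) (at \<phi>)"
          unfolding s_def sphere_height_def by (auto intro!: derivative_eq_intros)
        have e: "((\<lambda>\<phi>. cos \<theta> * sin (\<phi> - b)) has_real_derivative cos \<theta> * cos (\<phi> - b)) (at \<phi>)"
          by (auto intro!: derivative_eq_intros)
        show "((\<lambda>\<phi>. g (s a b \<theta> \<phi>) * (cos \<theta> * sin (\<phi> - b))) has_vector_derivative F2 \<theta> \<phi>) (at \<phi> within {0..2 * pi})"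
          using DERIV_mult[OF DERIV_chain2[OF g d] e]
          by (simp add: F2_def has_real_derivative_iff_has_vector_derivative has_vector_derivative_at_within mult.commute)
      qed simp
      moreover have "s a b \<theta> (2 * pi) = s a b \<theta> 0" "sin (2 * pi - b) = sin (0 - b)"
        by (simp_all add: s_def sphere_height_def cos_diff sin_diff)
      ultimately show ?thesis by (simp add: integral_unique)
    qed
    then show ?thesis
      using integral_prod_continuous[OF c2] by simp
  qed
  have "integral (cbox (0, 0) (pi, 2 * pi)) (\<lambda>z. g' (s a b (fst z) (snd z)) * sa a (fst z) (snd z) * sin (fst z)) = 0"
    unfolding eq
    using integral_diff[OF integrable_continuous[OF c2] integrable_continuous[OF c1]] I1 I2
    by (simp add: case_prod_beta)
  moreover have "sphere_integral b g = (\<lambda>a. integral (cbox (0, 0) (pi, 2 * pi)) (\<lambda>z. g (s a b (fst z) (snd z)) * sin (fst z)))"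
    by (simp only: sphere_integral_def [abs_def] s_def case_prod_beta')
  ultimately show ?thesis using deriv by simp
qed

text \<open>Allows passage to uniform limits. \<open>2 * pi^2\<close> is the area of the parameter
  rectangle, \<open>sin \<theta>\<close> being bounded by 1.\<close>

lemma sphere_integral_diff_bound:
  assumes f: "continuous_on {-1..1} f" and g: "continuous_on {-1..1} g"
    and le: "\<And>x. \<bar>x\<bar> \<le> 1 \<Longrightarrow> \<bar>f x - g x\<bar> \<le> e"
  shows "\<bar>sphere_integral b f a - sphere_integral b g a\<bar> \<le> e * (2 * pi\<^sup>2)"
proof -
  let ?Q = "cbox (0, 0) (pi, 2 * pi) :: (real \<times> real) set"
  have "sphere_integral b f a - sphere_integral b g a =
     integral ?Q (\<lambda>z. (case z of (\<theta>, \<phi>) \<Rightarrow> f (sphere_height a b \<theta> \<phi>) * sin \<theta>) - (case z of (\<theta>, \<phi>) \<Rightarrow> g (sphere_height a b \<theta> \<phi>) * sin \<theta>))"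
    unfolding sphere_integral_def
    by (rule integral_diff[symmetric]) (intro sphere_integrand_integrable f g)+
  also have "norm \<dots> \<le> e * measure lborel ?Q"
  proof (rule integrable_bound)
    show "0 \<le> e" using le[of 0] by (simp add: order_trans[OF abs_ge_zero])
    show "(\<lambda>z. (case z of (\<theta>, \<phi>) \<Rightarrow> f (sphere_height a b \<theta> \<phi>) * sin \<theta>) - (case z of (\<theta>, \<phi>) \<Rightarrow> g (sphere_height a b \<theta> \<phi>) * sin \<theta>)) integrable_on ?Q"
      by (intro integrable_diff sphere_integrand_integrable f g)
    fix z :: "real \<times> real"
    have "\<bar>(f x - g x) * sin t\<bar> \<le> e * 1" if "\<bar>x\<bar> \<le> 1" for x t
      unfolding abs_mult using le[OF that] by (intro mult_mono) (auto intro: order_trans[OF abs_ge_zero])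
    then show "norm ((case z of (\<theta>, \<phi>) \<Rightarrow> f (sphere_height a b \<theta> \<phi>) * sin \<theta>) - (case z of (\<theta>, \<phi>) \<Rightarrow> g (sphere_height a b \<theta> \<phi>) * sin \<theta>)) \<le> e"
      using sphere_height_bound by (auto simp: case_prod_beta left_diff_distrib[symmetric])
  qed
  also have "measure lborel ?Q = 2 * pi\<^sup>2" by (simp add: content_Pair power2_eq_square)
  finally show ?thesis by simp
qed

text \<open>The derivative lemma asks for a profile differentiable on the whole line, while
  \<open>g\<close> is only continuous on \<open>{-1..1}\<close>. Polynomials close the gap: with
  uniform error \<open>d / (8 * pi^2)\<close> each of the two integrals moves by at most
  \<open>d / 4\<close>, too little to account for a difference \<open>d\<close>.\<close>

lemma sphere_integral_rotation_invariant:
  assumes g: "continuous_on {-1..1} g"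
  shows "sphere_integral b g a = sphere_integral b g 0"
proof (rule ccontr)
  define d where "d = \<bar>sphere_integral b g a - sphere_integral b g 0\<bar>"
  assume "sphere_integral b g a \<noteq> sphere_integral b g 0"
  then have d: "d > 0" by (simp add: d_def)
  define e where "e = d / (8 * pi\<^sup>2)"
  have e: "e > 0" "e * (2 * pi\<^sup>2) = d / 4" using d by (simp_all add: e_def)
  obtain p where p: "real_polynomial_function p" "\<And>x. x \<in> {-1..1} \<Longrightarrow> \<bar>g x - p x\<bar> < e"
    using Stone_Weierstrass_real_polynomial_function[OF _ g e(1)] by auto
  obtain p' where p': "real_polynomial_function p'" "\<And>x. (p has_real_derivative p' x) (at x)"
    using has_real_derivative_polynomial_function[OF p(1)] by blast
  have "continuous_on UNIV p'"
    using p'(1) continuous_on_polymonial_function real_polynomial_function_eq by blast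
  then have "sphere_integral b p a = sphere_integral b p 0"
    using DERIV_isconst_all[of "sphere_integral b p" a 0] sphere_integral_smooth_derivative[OF p'(2)] by blast
  moreover have "continuous_on {-1..1} p"
    using p'(2) by (meson DERIV_isCont continuous_at_imp_continuous_on)
  then have "\<bar>sphere_integral b g t - sphere_integral b p t\<bar> \<le> d / 4" for t
    using sphere_integral_diff_bound[OF g, of p e b t] p(2) e(2) by (force simp: abs_le_iff less_imp_le)
  from this[of a] this[of 0] have "\<bar>sphere_integral b g a - sphere_integral b p a\<bar> \<le> d / 4"
     "\<bar>sphere_integral b g 0 - sphere_integral b p 0\<bar> \<le> d / 4" by auto
  moreover have "d \<le> \<bar>sphere_integral b g a - sphere_integral b p a\<bar>
     + \<bar>sphere_integral b g 0 - sphere_integral b p 0\<bar>"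
    unfolding d_def \<open>sphere_integral b p a = sphere_integral b p 0\<close> by linarith
  ultimately show False using d by linarith
qed

text \<open>With the axis rotated to the pole the height is \<open>cos \<theta>\<close>, and the
  \<open>\<phi>\<close>-integration contributes just a factor \<open>2 * pi\<close>.\<close>

lemma sphere_integral_zonal:
  assumes g: "continuous_on {-1..1} g"
  shows "integral {0..pi} (\<lambda>\<theta>. integral {0..2 * pi} (\<lambda>\<phi>. g (sphere_height a b \<theta> \<phi>) * sin \<theta>))
    = 2 * pi * integral {0..pi} (\<lambda>\<theta>. g (cos \<theta>) * sin \<theta>)"
proof -
  have iter: "sphere_integral b g a =
     integral {0..pi} (\<lambda>\<theta>. integral {0..2 * pi} (\<lambda>\<phi>. g (sphere_height a b \<theta> \<phi>) * sin \<theta>))" for a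
  proof -
    have "continuous_on (cbox (0, 0) (pi, 2 * pi)) (\<lambda>(\<theta>, \<phi>). g (sphere_height a b \<theta> \<phi>) * sin \<theta>)"
      unfolding case_prod_beta
      by (intro continuous_intros continuous_on_compose_real[OF g] continuous_on_sphere_height sphere_height_bound)
    from integral_prod_continuous[OF this] show ?thesis by (simp add: sphere_integral_def)
  qed
  have "integral {0..2 * pi} (\<lambda>\<phi>. g (sphere_height 0 b \<theta> \<phi>) * sin \<theta>) = 2 * pi * (g (cos \<theta>) * sin \<theta>)" for \<theta>
    by (simp add: sphere_height_def)
  then show ?thesis
    using iter[of a] iter[of 0] sphere_integral_rotation_invariant[OF g, of b a]
    by (simp only: integral_mult_right)
qed

section \<open>Differentiability of the kernel along meridians and circles of latitude\<close>

text \<open>Derivatives appear as witnesses, so that closure rules compose without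
  \<open>deriv\<close>. The second one is only asked to exist, since the trapezoidal rule takes a
  pointwise bound on it.\<close>

definition twice_differentiable_on :: "real set \<Rightarrow> (real \<Rightarrow> real) \<Rightarrow> bool" where
  "twice_differentiable_on S f \<longleftrightarrow> (\<exists>f' f''. \<forall>t\<in>S.
     (f has_real_derivative f' t) (at t) \<and> (f' has_real_derivative f'' t) (at t))"

lemma twice_differentiable_onI:
  assumes "\<And>t. t \<in> S \<Longrightarrow> (f has_real_derivative f' t) (at t)"
    and "\<And>t. t \<in> S \<Longrightarrow> (f' has_real_derivative f'' t) (at t)"
  shows "twice_differentiable_on S f"
  using assms unfolding twice_differentiable_on_def by blast

text \<open>The bridge to suprema stated with \<open>deriv ^^ 2\<close>. On the whole line
  \<open>deriv f\<close> and the witness \<open>f'\<close> agree as functions, so they have the same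
  derivative.\<close>

lemma twice_differentiable_on_UNIV_deriv:
  assumes "twice_differentiable_on UNIV f"
  shows "(f has_real_derivative deriv f t) (at t)"
    and "(deriv f has_real_derivative (deriv ^^ 2) f t) (at t)"
proof -
  obtain f' f'' where f: "\<And>t. (f has_real_derivative f' t) (at t)"
      "\<And>t. (f' has_real_derivative f'' t) (at t)"
    using assms unfolding twice_differentiable_on_def by blast
  have 1: "deriv f = f'" using f(1) by (auto intro: DERIV_imp_deriv)
  have "deriv f' t = f'' t" for t using f(2) by (auto intro: DERIV_imp_deriv)
  with 1 f show "(f has_real_derivative deriv f t) (at t)"
    and "(deriv f has_real_derivative (deriv ^^ 2) f t) (at t)"
    by (auto simp: numeral_2_eq_2)
qed

lemma C2_function_twice_differentiable:
  assumes "C2_function f"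
  shows "twice_differentiable_on UNIV f"
proof -
  obtain D where D: "\<And>x. (deriv f has_vector_derivative D x) (at x)"
    using assms unfolding C2_function_def C1_differentiable_on_def by auto
  show ?thesis
  proof (rule twice_differentiable_onI)
    show "(f has_real_derivative deriv f t) (at t)" for t
      using assms unfolding C2_function_def by (simp add: DERIV_deriv_iff_real_differentiable)
    show "(deriv f has_real_derivative D t) (at t)" for t
      using D by (simp add: has_real_derivative_iff_has_vector_derivative)
  qed
qed

section \<open>Closure properties of twice differentiable functions\<close>

lemma twice_differentiable_on_const: "twice_differentiable_on S (\<lambda>_. c)"
  by (rule twice_differentiable_onI[where f' = "\<lambda>_. 0" and f'' = "\<lambda>_. 0"]) auto

lemma twice_differentiable_on_affine: "twice_differentiable_on S (\<lambda>t. a * t + b)"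
  by (rule twice_differentiable_onI[where f' = "\<lambda>_. a" and f'' = "\<lambda>_. 0"])
    (auto intro!: derivative_eq_intros)

lemma twice_differentiable_on_add:
  assumes "twice_differentiable_on S f" "twice_differentiable_on S g"
  shows "twice_differentiable_on S (\<lambda>t. f t + g t)"
proof -
  obtain f' f'' g' g'' where d: "\<And>t. t \<in> S \<Longrightarrow> (f has_real_derivative f' t) (at t)"
      "\<And>t. t \<in> S \<Longrightarrow> (f' has_real_derivative f'' t) (at t)"
      "\<And>t. t \<in> S \<Longrightarrow> (g has_real_derivative g' t) (at t)"
      "\<And>t. t \<in> S \<Longrightarrow> (g' has_real_derivative g'' t) (at t)"
    using assms unfolding twice_differentiable_on_def by metis
  show ?thesis
    by (rule twice_differentiable_onI[where f' = "\<lambda>t. f' t + g' t" and f'' = "\<lambda>t. f'' t + g'' t"])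
      (auto intro!: DERIV_add d)
qed

lemma twice_differentiable_on_mult:
  assumes "twice_differentiable_on S f" "twice_differentiable_on S g"
  shows "twice_differentiable_on S (\<lambda>t. f t * g t)"
proof -
  obtain f' f'' g' g'' where d: "\<And>t. t \<in> S \<Longrightarrow> (f has_real_derivative f' t) (at t)"
      "\<And>t. t \<in> S \<Longrightarrow> (f' has_real_derivative f'' t) (at t)"
      "\<And>t. t \<in> S \<Longrightarrow> (g has_real_derivative g' t) (at t)"
      "\<And>t. t \<in> S \<Longrightarrow> (g' has_real_derivative g'' t) (at t)"
    using assms unfolding twice_differentiable_on_def by metis
  show ?thesis
    by (rule twice_differentiable_onI[where f' = "\<lambda>t. f' t * g t + g' t * f t"
        and f'' = "\<lambda>t. (f'' t * g t + g' t * f' t) + (g'' t * f t + f' t * g' t)"])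
      (assumption | rule DERIV_add DERIV_mult d)+
qed

lemma twice_differentiable_on_compose:
  assumes g: "twice_differentiable_on S g" and f: "twice_differentiable_on T f"
    and sub: "\<And>t. t \<in> T \<Longrightarrow> f t \<in> S"
  shows "twice_differentiable_on T (\<lambda>t. g (f t))"
proof -
  obtain g' g'' where g: "\<And>t. t \<in> S \<Longrightarrow> (g has_real_derivative g' t) (at t)"
      "\<And>t. t \<in> S \<Longrightarrow> (g' has_real_derivative g'' t) (at t)"
    using g unfolding twice_differentiable_on_def by metis
  obtain f' f'' where f: "\<And>t. t \<in> T \<Longrightarrow> (f has_real_derivative f' t) (at t)"
      "\<And>t. t \<in> T \<Longrightarrow> (f' has_real_derivative f'' t) (at t)"
    using f unfolding twice_differentiable_on_def by metis
  show ?thesis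
    by (rule twice_differentiable_onI[where f' = "\<lambda>t. g' (f t) * f' t"
        and f'' = "\<lambda>t. (g'' (f t) * f' t) * f' t + f'' t * g' (f t)"])
      (auto intro!: DERIV_mult DERIV_chain2[of g] DERIV_chain2[of g'] f g sub)
qed

lemma twice_differentiable_on_sin: "twice_differentiable_on S sin"
  by (rule twice_differentiable_onI[where f' = cos and f'' = "\<lambda>t. - sin t"])
    (auto intro!: derivative_eq_intros)

lemma twice_differentiable_on_cos: "twice_differentiable_on S cos"
  by (rule twice_differentiable_onI[where f' = "\<lambda>t. - sin t" and f'' = "\<lambda>t. - cos t"])
    (auto intro!: derivative_eq_intros)

lemma inverse_sqrt_one_minus_square_derivative:
  fixes t :: real
  assumes "t \<in> {-1<..<1}"
  shows "((\<lambda>t. inverse (sqrt (1 - t\<^sup>2))) has_real_derivative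
    t * inverse (sqrt (1 - t\<^sup>2)) / (1 - t\<^sup>2)) (at t)"
proof -
  have p: "1 - t\<^sup>2 > 0" using assms by (simp add: abs_square_less_1 abs_less_iff)
  show ?thesis
    using p by (auto intro!: derivative_eq_intros simp: field_simps power2_eq_square)
qed

lemma twice_differentiable_on_arcsin: "twice_differentiable_on {-1<..<1} arcsin"
  by (rule twice_differentiable_onI[OF _ inverse_sqrt_one_minus_square_derivative])
    (auto intro!: DERIV_arcsin)

lemma twice_differentiable_on_arccos: "twice_differentiable_on {-1<..<1} arccos"
  by (rule twice_differentiable_onI[OF _ DERIV_minus[OF inverse_sqrt_one_minus_square_derivative]])
    (auto intro!: DERIV_arccos[simplified])

lemmas twice_differentiable_on_intros =
  twice_differentiable_on_const twice_differentiable_on_affine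
  twice_differentiable_on_add twice_differentiable_on_mult
  twice_differentiable_on_compose[OF twice_differentiable_on_sin[of UNIV]]
  twice_differentiable_on_compose[OF twice_differentiable_on_cos[of UNIV]]

text \<open>An even, \<open>2\<pi>\<close>-periodic \<open>p\<close> satisfies \<open>p (arccos (cos \<beta>)) = p \<beta>\<close>, so \<open>p \<circ> arccos \<circ> s\<close> is smooth
  along every curve \<open>s\<close> of this kind, even where \<open>arccos\<close> is not differentiable.\<close>

definition cos_liftable :: "(real \<Rightarrow> real) \<Rightarrow> bool" where
  "cos_liftable s \<longleftrightarrow> (\<exists>\<beta>. twice_differentiable_on UNIV \<beta> \<and> (\<forall>t. s t = cos (\<beta> t)))"

lemma cos_liftableI:
  assumes "twice_differentiable_on UNIV \<beta>" "\<And>t. s t = cos (\<beta> t)"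
  shows "cos_liftable s"
  using assms unfolding cos_liftable_def by blast

text \<open>Away from \<open>-1\<close> and \<open>1\<close>, \<open>arccos\<close> is smooth and
  provides the lift itself.\<close>

lemma cos_liftable_interior:
  assumes "twice_differentiable_on UNIV s" and s: "\<And>t. \<bar>s t\<bar> < 1"
  shows "cos_liftable s"
proof (rule cos_liftableI)
  have "s t \<in> {-1<..<1}" for t using s[of t] by auto
  then show "twice_differentiable_on UNIV (\<lambda>t. arccos (s t))"
    by (intro twice_differentiable_on_compose[OF twice_differentiable_on_arccos] assms) auto
  show "s t = cos (arccos (s t))" for t
    using s[of t] by (simp add: cos_arccos_abs)
qed

lemma cos_liftable_uminus:
  assumes "cos_liftable s"
  shows "cos_liftable (\<lambda>t. - s t)"
proof -
  obtain \<beta> where \<beta>: "twice_differentiable_on UNIV \<beta>" "\<And>t. s t = cos (\<beta> t)"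
    using assms unfolding cos_liftable_def by blast
  show ?thesis
  proof (rule cos_liftableI)
    show "twice_differentiable_on UNIV (\<lambda>t. (- 1) * \<beta> t + pi)"
      by (intro twice_differentiable_on_intros \<beta>)
    show "- s t = cos ((- 1) * \<beta> t + pi)" for t using \<beta>(2) by simp
  qed
qed

text \<open>Along a meridian the height is a sinusoid of amplitude \<open>sqrt (P^2 + Q^2)\<close>.
  At amplitude 1 it is a shifted cosine with an affine lift; below 1 it stays off the singular
  values.\<close>

lemma cos_liftable_great_circle:
  assumes "P\<^sup>2 + Q\<^sup>2 \<le> 1"
  shows "cos_liftable (\<lambda>t. P * sin t + Q * cos t)"
proof (cases "P\<^sup>2 + Q\<^sup>2 = 1")
  case True
  then obtain d where d: "P = cos d" "Q = sin d" by (rule sincos_total_2pi)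
  show ?thesis
  proof (rule cos_liftableI)
    show "twice_differentiable_on UNIV (\<lambda>t. 1 * t + (d - pi / 2))"
      by (rule twice_differentiable_on_affine)
    have "cos (1 * t + (d - pi / 2)) = sin (t + d)" for t
      using cos_diff[of "t + d" "pi / 2"] by (simp add: add_diff_eq)
    then show "P * sin t + Q * cos t = cos (1 * t + (d - pi / 2))" for t
      by (simp only: d sin_add) (simp add: mult.commute)
  qed
next
  case False
  show ?thesis
  proof (rule cos_liftable_interior)
    show "twice_differentiable_on UNIV (\<lambda>t. P * sin t + Q * cos t)"
      by (intro twice_differentiable_on_intros twice_differentiable_on_sin twice_differentiable_on_cos)
    fix t
    have "(P * sin t + Q * cos t)\<^sup>2 + (P * cos t - Q * sin t)\<^sup>2 = (P\<^sup>2 + Q\<^sup>2) * ((sin t)\<^sup>2 + (cos t)\<^sup>2)"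
      by (simp only: power2_eq_square) algebra
    then have "(P * sin t + Q * cos t)\<^sup>2 \<le> P\<^sup>2 + Q\<^sup>2"
      by (metis le_add_same_cancel1 mult.right_neutral sin_cos_squared_add zero_le_power2)
    also have "\<dots> < 1" using assms False by simp
    finally have "(P * sin t + Q * cos t)\<^sup>2 < 1" .
    then show "\<bar>P * sin t + Q * cos t\<bar> < 1" by (simp add: abs_square_less_1)
  qed
qed

text \<open>The circle of latitude reaches a pole only if \<open>\<bar>P\<bar> + \<bar>Q\<bar> = 1\<close>; for \<open>Q \<ge> 0\<close> the half-angle
  formula then gives \<open>P cos \<psi> + Q = 1 - 2 v\<^sup>2 = cos (2 arcsin v)\<close> with \<open>v = \<surd>\<bar>P\<bar> sin (\<psi> / 2)\<close> or
  \<open>\<surd>\<bar>P\<bar> cos (\<psi> / 2)\<close>, which is free of the singularity of \<open>arccos\<close> at \<open>\<plusminus>1\<close>.\<close>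

lemma cos_liftable_latitude:
  assumes PQ: "\<bar>P\<bar> + \<bar>Q\<bar> \<le> 1"
  shows "cos_liftable (\<lambda>t. P * cos (t - b) + Q)"
proof -
  have touching: "cos_liftable (\<lambda>t. P * cos (t - b) + Q)" if PQ: "\<bar>P\<bar> + Q = 1" "0 \<le> Q" for P Q
  proof (cases "\<bar>P\<bar> = 1")
    case True
    \<comment> \<open>\<open>\<bar>P\<bar> = 1\<close> forces \<open>Q = 0\<close>, which leaves a
      cosine or its negative, the latter being a shift by \<open>pi\<close>.\<close>
    define d where "d = (if P = 1 then 0 else pi)"
    show ?thesis
    proof (rule cos_liftableI)
      show "twice_differentiable_on UNIV (\<lambda>t. 1 * t + (d - b))"
        by (rule twice_differentiable_on_affine)
      have shift: "1 * t + (d - b) = (t - b) + d" for t by simp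
      show "P * cos (t - b) + Q = cos (1 * t + (d - b))" for t
        unfolding shift using True PQ unfolding d_def by (auto simp: abs_if split: if_splits)
    qed
  next
    case False
    \<comment> \<open>\<open>r < 1\<close> keeps \<open>v\<close> in the open interval where
      \<open>arcsin\<close> is smooth. The shift \<open>d\<close> turns the half-angle sine into a
      cosine when \<open>P\<close> is negative.\<close>
    define r where "r = sqrt \<bar>P\<bar>"
    define d where "d = (if P \<ge> 0 then 0 else pi / 2)"
    define v where "v t = r * sin ((1 / 2) * t + (d - b / 2))" for t
    have r: "0 \<le> r" "r < 1" "r\<^sup>2 = \<bar>P\<bar>" using PQ False by (auto simp: r_def)
    have "\<bar>v t\<bar> < 1" for t
    proof -
      have "\<bar>v t\<bar> \<le> r * 1" unfolding v_def abs_mult using r by (intro mult_mono) auto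
      then show ?thesis using r by simp
    qed
    then have v: "v t \<in> {-1<..<1}" for t by (simp add: abs_less_iff minus_less_iff)
    show ?thesis
    proof (rule cos_liftableI)
      have "twice_differentiable_on UNIV v"
        unfolding v_def by (intro twice_differentiable_on_intros) auto
      then show "twice_differentiable_on UNIV (\<lambda>t. 2 * arcsin (v t))"
        using v by (intro twice_differentiable_on_intros
            twice_differentiable_on_compose[OF twice_differentiable_on_arcsin]) auto
      fix t
      have half: "(1 / 2) * t + (d - b / 2) = (t - b) / 2 + d" by (simp add: field_simps)
      have "cos (2 * arcsin (v t)) = 1 - 2 * (v t)\<^sup>2"
        using v[of t] by (simp add: cos_double_sin)
      also have "\<dots> = 1 - \<bar>P\<bar> * (2 * (sin ((t - b) / 2 + d))\<^sup>2)"
        unfolding v_def half by (simp add: power_mult_distrib r)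
      also have "2 * (sin ((t - b) / 2 + d))\<^sup>2 = 1 - cos (2 * ((t - b) / 2 + d))"
        by (simp only: cos_double_sin)
      also have "2 * ((t - b) / 2 + d) = (t - b) + 2 * d" by (simp add: field_simps)
      also have "1 - \<bar>P\<bar> * (1 - cos ((t - b) + 2 * d)) = P * cos (t - b) + Q"
      proof (cases "P \<ge> 0")
        case True
        then show ?thesis using PQ by (simp add: d_def algebra_simps)
      next
        case False
        then have "cos ((t - b) + 2 * d) = - cos (t - b)" by (simp add: d_def)
        then show ?thesis using False PQ by (simp add: algebra_simps)
      qed
      finally show "P * cos (t - b) + Q = cos (2 * arcsin (v t))" by simp
    qed
  qed
  show ?thesis
  proof (cases "\<bar>P\<bar> + \<bar>Q\<bar> = 1")
    case True
    show ?thesis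
    proof (cases "0 \<le> Q")
      case True
      then show ?thesis using touching[of P Q] \<open>\<bar>P\<bar> + \<bar>Q\<bar> = 1\<close> by simp
    next
      case False
      then show ?thesis
        using cos_liftable_uminus[OF touching[of "- P" "- Q"]] \<open>\<bar>P\<bar> + \<bar>Q\<bar> = 1\<close> by (simp add: algebra_simps)
    qed
  next
    case False
    show ?thesis
    proof (rule cos_liftable_interior)
      have "twice_differentiable_on UNIV (\<lambda>t. P * cos (1 * t + (- b)) + Q)"
        by (intro twice_differentiable_on_intros) auto
      then show "twice_differentiable_on UNIV (\<lambda>t. P * cos (t - b) + Q)" by simp
      fix t
      have "\<bar>P * cos (t - b)\<bar> \<le> \<bar>P\<bar> * 1" unfolding abs_mult by (intro mult_mono) auto
      then show "\<bar>P * cos (t - b) + Q\<bar> < 1" using PQ False by linarith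
    qed
  qed
qed

text \<open>\<open>arccos (cos t)\<close> is \<open>t\<close> folded into \<open>{0..pi}\<close> by
  full turns and a reflection, the two symmetries of \<open>p\<close>.\<close>

lemma even_periodic_arccos_cos:
  fixes p :: "real \<Rightarrow> 'a"
  assumes periodic: "\<And>\<alpha>. p (\<alpha> + 2 * pi) = p \<alpha>" and even: "\<And>\<alpha>. p (- \<alpha>) = p \<alpha>"
  shows "p (arccos (cos t)) = p t"
proof -
  have nat: "p (\<alpha> + real n * (2 * pi)) = p \<alpha>" for \<alpha> n
  proof (induction n)
    case (Suc n)
    have "p (\<alpha> + real (Suc n) * (2 * pi)) = p (\<alpha> + real n * (2 * pi) + 2 * pi)"
      by (simp add: algebra_simps)
    then show ?case using periodic Suc by simp
  qed simp
  have int: "p (\<alpha> + of_int k * (2 * pi)) = p \<alpha>" for \<alpha> k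
  proof (cases "0 \<le> k")
    case True
    then show ?thesis using nat[of \<alpha> "Int.nat k"] by simp
  next
    case False
    then show ?thesis using nat[of "\<alpha> + of_int k * (2 * pi)" "Int.nat (- k)"] by simp
  qed
  obtain k where k: "arccos (cos t) = \<bar>t - of_int k * (2 * pi)\<bar>"
    by (rule arccos_cos_eq_abs_2pi)
  have "p \<bar>t - of_int k * (2 * pi)\<bar> = p (t - of_int k * (2 * pi))"
    using even[of "t - of_int k * (2 * pi)"] by (auto simp: abs_if)
  also have "\<dots> = p t" using int[of t "- k"] by simp
  finally show ?thesis using k by simp
qed

lemma twice_differentiable_arccos_liftable:
  assumes "\<And>\<alpha>. p (\<alpha> + 2 * pi) = p \<alpha>" "\<And>\<alpha>. p (- \<alpha>) = p \<alpha>"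
    and p: "twice_differentiable_on UNIV p" and s: "cos_liftable s"
  shows "twice_differentiable_on UNIV (\<lambda>t. p (arccos (s t)))"
proof -
  obtain \<beta> where \<beta>: "twice_differentiable_on UNIV \<beta>" "\<And>t. s t = cos (\<beta> t)"
    using s unfolding cos_liftable_def by blast
  have "p (arccos (s t)) = p (\<beta> t)" for t
    unfolding \<beta>(2) by (rule even_periodic_arccos_cos) (use assms in auto)
  then show ?thesis
    using twice_differentiable_on_compose[OF p \<beta>(1)] by simp
qed

section \<open>The quadrature sum of the kernel\<close>

lemma deriv_periodic:
  fixes f :: "real \<Rightarrow> real"
  assumes "\<And>t. f (t + c) = f t"
  shows "deriv f (t + c) = deriv f t"
proof -
  have "(\<lambda>x. f (x + c)) = f" using assms by auto
  then have "(f has_real_derivative D) (at (t + c)) \<longleftrightarrow> (f has_real_derivative D) (at t)" for D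
    using DERIV_shift[of f D t c] by simp
  then show ?thesis by (simp add: deriv_def)
qed

text \<open>The error splits in two: the \<open>\<phi>\<close> rule at fixed
  \<open>\<theta>\<close>, integrated over \<open>\<theta>\<close>, and the \<open>\<theta>\<close>
  rule at fixed \<open>\<phi>\<close>, summed over the \<open>\<phi>\<close> nodes. Each rule acts
  along one coordinate line at a time, so no mixed derivative occurs.\<close>

lemma trapezoid_kernel_sum:
  fixes p :: "real \<Rightarrow> real" and M\<theta> M\<phi> :: nat
  defines "k \<equiv> \<lambda>a b \<theta> \<phi>. p (arccos (sphere_height a b \<theta> \<phi>)) * sin \<theta>"
  assumes periodic: "\<And>\<alpha>. p (\<alpha> + 2 * pi) = p \<alpha>" and even: "\<And>\<alpha>. p (- \<alpha>) = p \<alpha>"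
    and p: "twice_differentiable_on UNIV p"
    and normalized: "2 * pi * integral {0..pi} (\<lambda>\<alpha>. p \<alpha> * sin \<alpha>) = 1"
    and M\<theta>: "M\<theta> > 0" and M\<phi>: "M\<phi> > 0"
    and \<Delta>\<theta>: "\<Delta>\<theta> = pi / real M\<theta>" and \<Delta>\<phi>: "\<Delta>\<phi> = 2 * pi / real M\<phi>"
    and A: "\<And>\<theta> \<phi>. \<theta> \<in> {0..pi} \<Longrightarrow> \<phi> \<in> {0..2 * pi} \<Longrightarrow> \<bar>(deriv ^^ 2) (\<lambda>\<theta>. k a b \<theta> \<phi>) \<theta>\<bar> \<le> A"
    and B: "\<And>\<theta> \<phi>. \<theta> \<in> {0..pi} \<Longrightarrow> \<phi> \<in> {0..2 * pi} \<Longrightarrow> \<bar>(deriv ^^ 2) (\<lambda>\<phi>. k a b \<theta> \<phi>) \<phi>\<bar> \<le> B"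
  shows "\<bar>\<Delta>\<theta> * \<Delta>\<phi> * (\<Sum>j<M\<theta>. \<Sum>n<M\<phi>. k a b (real j * \<Delta>\<theta>) (real n * \<Delta>\<phi>)) - 1\<bar>
    \<le> pi\<^sup>2 / 6 * (\<Delta>\<theta>\<^sup>2 * A + \<Delta>\<phi>\<^sup>2 / 2 * B)"
proof -
  have pos: "\<Delta>\<theta> > 0" "\<Delta>\<phi> > 0" and N: "real M\<theta> * \<Delta>\<theta> = pi" "real M\<phi> * \<Delta>\<phi> = 2 * pi"
    using \<Delta>\<theta> \<Delta>\<phi> M\<theta> M\<phi> by auto
  let ?k = "k a b"
  have d\<theta>: "twice_differentiable_on UNIV (\<lambda>\<theta>. ?k \<theta> \<phi>)" for \<phi>
  proof -
    have "(sin a * cos (\<phi> - b))\<^sup>2 + (cos a)\<^sup>2 \<le> (sin a)\<^sup>2 * 1 + (cos a)\<^sup>2"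
      unfolding power_mult_distrib
      by (intro add_right_mono mult_left_mono) (auto simp: abs_square_le_1)
    then have "cos_liftable (\<lambda>\<theta>. (sin a * cos (\<phi> - b)) * sin \<theta> + cos a * cos \<theta>)"
      by (intro cos_liftable_great_circle) simp
    then have "cos_liftable (\<lambda>\<theta>. sphere_height a b \<theta> \<phi>)"
      by (simp add: sphere_height_def mult.commute mult.left_commute)
    then show ?thesis unfolding k_def
      by (intro twice_differentiable_on_mult twice_differentiable_on_sin
          twice_differentiable_arccos_liftable periodic even p)
  qed
  have d\<phi>: "twice_differentiable_on UNIV (\<lambda>\<phi>. ?k \<theta> \<phi>)" for \<theta>
  proof -
    have "\<bar>sin a * sin \<theta>\<bar> + \<bar>cos a * cos \<theta>\<bar> \<le> 1"
    proof -
      \<comment> \<open>\<open>\<bar>x\<bar> + \<bar>y\<bar>\<close> is the larger of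
        \<open>\<bar>y + x\<bar>\<close> and \<open>\<bar>y - x\<bar>\<close>; here
        \<open>y + x\<close> is \<open>cos (a - \<theta>)\<close> and \<open>y - x\<close> is
        \<open>cos (a + \<theta>)\<close>.\<close>
      have "\<bar>x\<bar> + \<bar>y\<bar> \<le> 1" if "\<bar>y + x\<bar> \<le> 1" "\<bar>y - x\<bar> \<le> 1" for x y :: real
        using that by linarith
      then show ?thesis
        using abs_cos_le_one[of "a - \<theta>"] abs_cos_le_one[of "a + \<theta>"] unfolding cos_diff cos_add .
    qed
    then have "cos_liftable (\<lambda>\<phi>. (sin a * sin \<theta>) * cos (\<phi> - b) + cos a * cos \<theta>)"
      by (rule cos_liftable_latitude)
    then show ?thesis unfolding k_def sphere_height_def
      by (intro twice_differentiable_on_mult twice_differentiable_on_const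
          twice_differentiable_arccos_liftable periodic even p)
  qed
  define g where "g = (\<lambda>s. p (arccos s))"
  have "continuous_on UNIV p"
    using twice_differentiable_on_UNIV_deriv(1)[OF p] DERIV_continuous_on by blast
  then have g: "continuous_on {-1..1} g"
    unfolding g_def by (rule continuous_on_compose2) (auto intro!: continuous_intros)
  have k_cont: "continuous_on S (\<lambda>z. ?k (u z) (v z))"
    if "continuous_on S u" "continuous_on S v" for S and u v :: "'z::t2_space \<Rightarrow> real"
    using continuous_on_compose_real[OF g continuous_on_sphere_height[of S "\<lambda>_. a" u v b]] that sphere_height_bound
    unfolding k_def g_def by (auto intro!: continuous_intros)
  \<comment> \<open>The factor \<open>sin \<theta>\<close> makes both end values zero, but the end
    slopes differ in general, so the standard bound is the one that applies.\<close>
  have E\<theta>: "\<bar>\<Delta>\<theta> * (\<Sum>j<M\<theta>. ?k (real j * \<Delta>\<theta>) \<phi>) - integral {0..pi} (\<lambda>\<theta>. ?k \<theta> \<phi>)\<bar> \<le> pi * \<Delta>\<theta>\<^sup>2 / 12 * A"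
    if "\<phi> \<in> {0..2 * pi}" for \<phi>
  proof -
    note d = twice_differentiable_on_UNIV_deriv[OF d\<theta>[of \<phi>]]
    have sum: "(\<Sum>j<M\<theta>. ?k (real j * \<Delta>\<theta>) \<phi> + ?k (real (Suc j) * \<Delta>\<theta>) \<phi>) = 2 * (\<Sum>j<M\<theta>. ?k (real j * \<Delta>\<theta>) \<phi>)"
      by (rule sum_trapezoid_eq) (simp add: N k_def)
    show ?thesis
      using trapezoid_rule(1)[where h = \<Delta>\<theta>, OF M\<theta> pi_gt_zero _ d A[OF _ that]] \<Delta>\<theta>
      unfolding add_0 sum by simp
  qed
  have E\<phi>: "\<bar>\<Delta>\<phi> * (\<Sum>n<M\<phi>. ?k \<theta> (real n * \<Delta>\<phi>)) - integral {0..2 * pi} (\<lambda>\<phi>. ?k \<theta> \<phi>)\<bar> \<le> 2 * pi * \<Delta>\<phi>\<^sup>2 / 24 * B"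
    if "\<theta> \<in> {0..pi}" for \<theta>
  proof -
    note d = twice_differentiable_on_UNIV_deriv[OF d\<phi>[of \<theta>]]
    have per: "?k \<theta> (\<phi> + 2 * pi) = ?k \<theta> \<phi>" for \<phi>
      using cos_periodic[of "\<phi> - b"] by (simp add: k_def sphere_height_def algebra_simps)
    have sum: "(\<Sum>n<M\<phi>. ?k \<theta> (real n * \<Delta>\<phi>) + ?k \<theta> (real (Suc n) * \<Delta>\<phi>)) = 2 * (\<Sum>n<M\<phi>. ?k \<theta> (real n * \<Delta>\<phi>))"
      by (rule sum_trapezoid_eq) (use per[of 0] N in simp)
    have ends: "deriv (?k \<theta>) 0 = deriv (?k \<theta>) (2 * pi)"
      using deriv_periodic[of "?k \<theta>" "2 * pi" 0] per by simp
    have width: "\<Delta>\<phi> = (2 * pi - 0) / real M\<phi>" using \<Delta>\<phi> by simp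
    from trapezoid_rule(2)[where a = 0 and b = "2 * pi", OF M\<phi> _ width d B[OF that] ends]
    show ?thesis unfolding add_0 sum by simp
  qed
  \<comment> \<open>\<open>J\<close> integrates out \<open>\<theta>\<close> at a fixed azimuth, and
    \<open>R\<close> is the error of the \<open>\<phi>\<close> rule at a fixed
    \<open>\<theta>\<close>. As the exact double integral is 1, the \<open>\<phi>\<close> sum of
    \<open>J\<close> misses 1 by exactly the integral of \<open>R\<close>.\<close>
  define J where "J \<phi> = integral {0..pi} (\<lambda>\<theta>. ?k \<theta> \<phi>)" for \<phi>
  define R where "R \<theta> = \<Delta>\<phi> * (\<Sum>n<M\<phi>. ?k \<theta> (real n * \<Delta>\<phi>)) - integral {0..2 * pi} (\<lambda>\<phi>. ?k \<theta> \<phi>)" for \<theta>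
  have k_int: "(\<lambda>\<theta>. ?k \<theta> \<phi>) integrable_on {0..pi}" for \<phi>
    by (intro integrable_continuous_real k_cont continuous_intros)
  have inner_int: "(\<lambda>\<theta>. integral {0..2 * pi} (\<lambda>\<phi>. ?k \<theta> \<phi>)) integrable_on {0..pi}"
    using integral_continuous_on_param[of "{0..pi}" 0 "2 * pi" ?k] k_cont[of "{0..pi} \<times> cbox 0 (2 * pi)" fst snd]
    by (auto intro!: integrable_continuous_real simp: case_prod_beta continuous_on_fst continuous_on_snd continuous_on_id)
  have sum_int: "(\<lambda>\<theta>. \<Delta>\<phi> * (\<Sum>n<M\<phi>. ?k \<theta> (real n * \<Delta>\<phi>))) integrable_on {0..pi}"
    by (intro integrable_on_mult_right integrable_sum k_int) auto
  have total: "integral {0..pi} (\<lambda>\<theta>. integral {0..2 * pi} (\<lambda>\<phi>. ?k \<theta> \<phi>)) = 1"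
  proof -
    have "integral {0..pi} (\<lambda>\<theta>. g (cos \<theta>) * sin \<theta>) = integral {0..pi} (\<lambda>\<alpha>. p \<alpha> * sin \<alpha>)"
      by (rule integral_cong) (simp add: g_def arccos_cos)
    then show ?thesis using sphere_integral_zonal[OF g, of a b] normalized unfolding k_def g_def by simp
  qed
  have "\<Delta>\<phi> * (\<Sum>n<M\<phi>. J (real n * \<Delta>\<phi>)) = integral {0..pi} (\<lambda>\<theta>. \<Delta>\<phi> * (\<Sum>n<M\<phi>. ?k \<theta> (real n * \<Delta>\<phi>)))"
    unfolding J_def by (subst integral_mult_right, subst integral_sum) (auto intro: k_int)
  also have "\<dots> = integral {0..pi} R + 1"
    unfolding R_def integral_diff[OF sum_int inner_int] total by simp
  finally have J_eq: "\<Delta>\<phi> * (\<Sum>n<M\<phi>. J (real n * \<Delta>\<phi>)) - 1 = integral {0..pi} R" by simp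
  have R_int: "R integrable_on {0..pi}"
    unfolding R_def by (intro integrable_diff sum_int inner_int)
  have "norm (integral {0..pi} R) \<le> integral {0..pi} (\<lambda>_. 2 * pi * \<Delta>\<phi>\<^sup>2 / 24 * B)"
    by (rule integral_norm_bound_integral[OF R_int]) (use E\<phi> in \<open>auto simp: R_def\<close>)
  then have R: "\<bar>integral {0..pi} R\<bar> \<le> pi * (2 * pi * \<Delta>\<phi>\<^sup>2 / 24 * B)" by (simp add: ac_simps)
  have grid: "real n * \<Delta>\<phi> \<in> {0..2 * pi}" if "n < M\<phi>" for n
  proof -
    have "real n * \<Delta>\<phi> \<le> real M\<phi> * \<Delta>\<phi>" using that pos by (intro mult_right_mono) auto
    then show ?thesis using N pos by simp
  qed
  define D where "D n = \<Delta>\<theta> * (\<Sum>j<M\<theta>. ?k (real j * \<Delta>\<theta>) (real n * \<Delta>\<phi>)) - J (real n * \<Delta>\<phi>)" for n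
  have "\<bar>\<Sum>n<M\<phi>. D n\<bar> \<le> (\<Sum>n<M\<phi>. pi * \<Delta>\<theta>\<^sup>2 / 12 * A)"
    by (rule order_trans[OF sum_abs sum_mono]) (use E\<theta> grid in \<open>auto simp: D_def J_def\<close>)
  then have "\<Delta>\<phi> * \<bar>\<Sum>n<M\<phi>. D n\<bar> \<le> \<Delta>\<phi> * (real M\<phi> * (pi * \<Delta>\<theta>\<^sup>2 / 12 * A))"
    using pos by (intro mult_left_mono) auto
  also have "\<dots> = real M\<phi> * \<Delta>\<phi> * (pi * \<Delta>\<theta>\<^sup>2 / 12 * A)" by (simp only: ac_simps)
  finally have D: "\<bar>\<Delta>\<phi> * (\<Sum>n<M\<phi>. D n)\<bar> \<le> 2 * pi * (pi * \<Delta>\<theta>\<^sup>2 / 12 * A)"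
    using pos N by (simp add: abs_mult)
  have "\<Delta>\<theta> * \<Delta>\<phi> * (\<Sum>j<M\<theta>. \<Sum>n<M\<phi>. ?k (real j * \<Delta>\<theta>) (real n * \<Delta>\<phi>))
      = \<Delta>\<phi> * (\<Sum>n<M\<phi>. \<Delta>\<theta> * (\<Sum>j<M\<theta>. ?k (real j * \<Delta>\<theta>) (real n * \<Delta>\<phi>)))"
    by (subst sum.swap) (simp add: sum_distrib_left mult.assoc mult.left_commute)
  also have "\<dots> - 1 = \<Delta>\<phi> * (\<Sum>n<M\<phi>. D n) + integral {0..pi} R"
    unfolding J_eq[symmetric] D_def sum_subtractf right_diff_distrib by simp
  also have "\<bar>\<dots>\<bar> \<le> 2 * pi * (pi * \<Delta>\<theta>\<^sup>2 / 12 * A) + pi * (2 * pi * \<Delta>\<phi>\<^sup>2 / 24 * B)"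
    by (rule order_trans[OF abs_triangle_ineq add_mono[OF D R]])
  also have "\<dots> = pi\<^sup>2 / 6 * (\<Delta>\<theta>\<^sup>2 * A + \<Delta>\<phi>\<^sup>2 / 2 * B)"
    by (simp add: power2_eq_square algebra_simps)
  finally show ?thesis .
qed

section \<open>From extended suprema to a real bound on the scattering weights\<close>

lemma sup_norm_bound:
  assumes "sup_norm S f = ennreal r" "0 \<le> r" "z \<in> S"
  shows "\<bar>f z\<bar> \<le> r"
proof -
  have "ennreal \<bar>f z\<bar> \<le> sup_norm S f"
    unfolding sup_norm_def using assms(3) by (rule SUP_upper)
  then show ?thesis using assms by (simp add: ennreal_le_iff)
qed

lemma sup_norm_le:
  assumes "\<And>z. z \<in> S \<Longrightarrow> \<bar>f z\<bar> \<le> r"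
  shows "sup_norm S f \<le> ennreal r"
  unfolding sup_norm_def by (intro SUP_least ennreal_leI assms)

lemma sup_norm_finiteE:
  assumes "bounded (f ` S)"
  obtains r where "0 \<le> r" "sup_norm S f = ennreal r"
proof -
  obtain B where "\<And>z. z \<in> S \<Longrightarrow> \<bar>f z\<bar> \<le> B"
    using assms unfolding bounded_iff by auto
  then have "sup_norm S f \<le> ennreal B" by (rule sup_norm_le)
  then have "sup_norm S f < top" using ennreal_less_top le_less_trans by blast
  then show ?thesis using that[of "enn2real (sup_norm S f)"] by simp
qed

lemma sum_int_atLeastAtMost_eq_nat:
  fixes f :: "int \<Rightarrow> 'a::comm_monoid_add"
  shows "(\<Sum>i\<in>{0..int n - 1}. f i) = (\<Sum>j<n. f (int j))"
  by (rule sum.reindex_bij_witness[of _ int nat]) auto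

text \<open>The upper half of the two-sided quadrature estimate, in the variables of the scheme. The
  direction \<open>sph a b\<close> is arbitrary because the indices \<open>m\<close> and
  \<open>n\<close> of the scheme range over all integers.\<close>

lemma kernel_quadrature_le:
  assumes x: "x \<in> box 0 L"
    and pt_periodic: "\<And>\<alpha>. pt x (\<alpha> + 2 * pi) = pt x \<alpha>"
    and pt_even: "\<And>\<alpha>. pt x (- \<alpha>) = pt x \<alpha>"
    and pt_C2: "C2_function (pt x)"
    and pt_normalized: "2 * pi * integral {0..pi} (\<lambda>\<alpha>. pt x \<alpha> * sin \<alpha>) = 1"
    and M\<theta>: "M\<theta> > 0" and M\<phi>: "M\<phi> > 0"
    and \<Delta>\<theta>: "\<Delta>\<theta> = pi / real M\<theta>" and \<Delta>\<phi>: "\<Delta>\<phi> = 2 * pi / real M\<phi>"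
    and r: "0 \<le> r"
    and angular: "ennreal (\<Delta>\<theta>\<^sup>2) * sup_dtheta2 L pt + ennreal (\<Delta>\<phi>\<^sup>2 / 2) * sup_dphi2 L pt
      \<le> ennreal (6 / pi\<^sup>2 * r)"
  shows "\<Delta>\<theta> * \<Delta>\<phi> * (\<Sum>\<mu>\<in>{1..int M\<theta> - 1}. \<Sum>\<nu>\<in>{0..int M\<phi> - 1}.
      scattering_kernel pt x (sph a b) (grid_direction \<Delta>\<theta> \<Delta>\<phi> \<mu> \<nu>) * sin (real_of_int \<mu> * \<Delta>\<theta>)) \<le> 1 + r"
proof -
  have pos: "\<Delta>\<theta> > 0" "\<Delta>\<phi> > 0" using \<Delta>\<theta> \<Delta>\<phi> M\<theta> M\<phi> by auto
  \<comment> \<open>The mesh widths are positive, so a finite weighted sum in \<open>ennreal\<close>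
    forces both suprema to be finite. Only then do \<open>A\<close> and \<open>B\<close> represent
    them, as \<open>enn2real\<close> sends infinity to 0.\<close>
  have finite: "sup_dtheta2 L pt < \<infinity>" "sup_dphi2 L pt < \<infinity>"
  proof -
    have "ennreal (\<Delta>\<theta>\<^sup>2) * sup_dtheta2 L pt + ennreal (\<Delta>\<phi>\<^sup>2 / 2) * sup_dphi2 L pt < top"
      using angular ennreal_less_top le_less_trans by blast
    then show "sup_dtheta2 L pt < \<infinity>" "sup_dphi2 L pt < \<infinity>"
      using pos by (auto simp: ennreal_mult_less_top ennreal_eq_0_iff)
  qed
  define A where "A = enn2real (sup_dtheta2 L pt)"
  define B where "B = enn2real (sup_dphi2 L pt)"
  have AB: "sup_dtheta2 L pt = ennreal A" "sup_dphi2 L pt = ennreal B" "0 \<le> A" "0 \<le> B"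
    using finite by (simp_all add: A_def B_def)
  have half: "0 \<le> \<Delta>\<phi>\<^sup>2 / 2" by simp
  have "ennreal (\<Delta>\<theta>\<^sup>2 * A + \<Delta>\<phi>\<^sup>2 / 2 * B) = ennreal (\<Delta>\<theta>\<^sup>2 * A) + ennreal (\<Delta>\<phi>\<^sup>2 / 2 * B)"
    by (rule ennreal_plus) (use AB in auto)
  also have "\<dots> \<le> ennreal (6 / pi\<^sup>2 * r)"
    using angular
    by (simp only: AB(1,2) ennreal_mult[OF zero_le_power2 AB(3)] ennreal_mult[OF half AB(4)])
  finally have "ennreal (\<Delta>\<theta>\<^sup>2 * A + \<Delta>\<phi>\<^sup>2 / 2 * B) \<le> ennreal (6 / pi\<^sup>2 * r)" .
  then have "\<Delta>\<theta>\<^sup>2 * A + \<Delta>\<phi>\<^sup>2 / 2 * B \<le> 6 / pi\<^sup>2 * r"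
    using r by (subst (asm) ennreal_le_iff) auto
  then have "pi\<^sup>2 / 6 * (\<Delta>\<theta>\<^sup>2 * A + \<Delta>\<phi>\<^sup>2 / 2 * B) \<le> pi\<^sup>2 / 6 * (6 / pi\<^sup>2 * r)"
    by (intro mult_left_mono) auto
  then have le_r: "pi\<^sup>2 / 6 * (\<Delta>\<theta>\<^sup>2 * A + \<Delta>\<phi>\<^sup>2 / 2 * B) \<le> r" by simp
  have \<xi>: "(x, sph a b) \<in> phase_space L" using x by (simp add: phase_space_def norm_sph)
  have kernel: "scattering_kernel pt x (sph a b) (sph \<theta> \<phi>) = pt x (arccos (sphere_height a b \<theta> \<phi>))" for \<theta> \<phi>
    by (simp add: scattering_kernel_def inner_sph)
  have A: "\<bar>(deriv ^^ 2) (\<lambda>\<theta>. pt x (arccos (sphere_height a b \<theta> \<phi>)) * sin \<theta>) \<theta>\<bar> \<le> A"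
    and B: "\<bar>(deriv ^^ 2) (\<lambda>\<phi>. pt x (arccos (sphere_height a b \<theta> \<phi>)) * sin \<theta>) \<phi>\<bar> \<le> B"
    if "\<theta> \<in> {0..pi}" "\<phi> \<in> {0..2 * pi}" for \<theta> \<phi>
  proof -
    have z: "((x, sph a b), \<theta>, \<phi>) \<in> phase_space L \<times> {0..pi} \<times> {0..2 * pi}" using \<xi> that by simp
    show "\<bar>(deriv ^^ 2) (\<lambda>\<theta>. pt x (arccos (sphere_height a b \<theta> \<phi>)) * sin \<theta>) \<theta>\<bar> \<le> A"
      using sup_norm_bound[OF AB(1)[unfolded sup_dtheta2_def] AB(3) z] by (simp add: kernel)
    show "\<bar>(deriv ^^ 2) (\<lambda>\<phi>. pt x (arccos (sphere_height a b \<theta> \<phi>)) * sin \<theta>) \<phi>\<bar> \<le> B"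
      using sup_norm_bound[OF AB(2)[unfolded sup_dphi2_def] AB(4) z] by (simp add: kernel)
  qed
  let ?f = "\<lambda>\<mu>. \<Sum>\<nu>\<in>{0..int M\<phi> - 1}.
      scattering_kernel pt x (sph a b) (grid_direction \<Delta>\<theta> \<Delta>\<phi> \<mu> \<nu>) * sin (real_of_int \<mu> * \<Delta>\<theta>)"
  \<comment> \<open>The scheme omits the node \<open>\<mu> = 0\<close>, whose weight
    \<open>sin 0\<close> vanishes; the node \<open>\<mu> = M\<theta>\<close> is in neither
    sum.\<close>
  have "{0..int M\<theta> - 1} = insert 0 {1..int M\<theta> - 1}" using M\<theta> by auto
  then have "(\<Sum>\<mu>\<in>{1..int M\<theta> - 1}. ?f \<mu>) = (\<Sum>\<mu>\<in>{0..int M\<theta> - 1}. ?f \<mu>)" by simp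
  also have "\<dots> = (\<Sum>j<M\<theta>. \<Sum>n<M\<phi>. pt x (arccos (sphere_height a b (real j * \<Delta>\<theta>) (real n * \<Delta>\<phi>))) * sin (real j * \<Delta>\<theta>))"
    by (simp add: sum_int_atLeastAtMost_eq_nat grid_direction_def kernel)
  finally have sum_eq: "(\<Sum>\<mu>\<in>{1..int M\<theta> - 1}. ?f \<mu>) = \<dots>" .
  note trapezoid_kernel_sum[of "pt x" M\<theta> M\<phi> \<Delta>\<theta> \<Delta>\<phi> a b A B, OF pt_periodic pt_even
      C2_function_twice_differentiable[OF pt_C2] pt_normalized M\<theta> M\<phi> \<Delta>\<theta> \<Delta>\<phi> A B]
  from order_trans[OF this le_r] show ?thesis unfolding sum_eq by linarith
qed

section \<open>The upwind scheme\<close>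

text \<open>A zero component falls into the second branch; the choice is harmless, since the weight
  of that neighbour is then zero.\<close>

definition upwind_neighbour ::
    "real \<Rightarrow> real \<Rightarrow> int^3 \<Rightarrow> int \<Rightarrow> int \<Rightarrow> 3 \<Rightarrow> int^3" where
  "upwind_neighbour \<Delta>\<theta> \<Delta>\<phi> i m n a =
    (if grid_direction \<Delta>\<theta> \<Delta>\<phi> m n $ a > 0 then i - axis a 1 else i + axis a 1)"

text \<open>The central difference and the viscosity term contribute opposite coefficients to the
  downwind value, so it drops out and only one-sided differences remain.\<close>

lemma A_\<Delta>_upwind:
  "A_\<Delta> \<Delta>x \<Delta>\<theta> \<Delta>\<phi> u i m n =
    (\<Sum>a\<in>UNIV. \<bar>grid_direction \<Delta>\<theta> \<Delta>\<phi> m n $ a\<bar> / \<Delta>x $ a *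
      (u (upwind_neighbour \<Delta>\<theta> \<Delta>\<phi> i m n a) m n - u i m n))"
  unfolding A_\<Delta>_def upwind_neighbour_def
proof (rule sum.cong[OF refl])
  fix a :: 3
  have pos: "- \<xi> * ((p - m) / (2 * d)) + \<xi> * ((p - 2 * v + m) / (2 * d)) = \<xi> / d * (m - v)"
    and neg: "- \<xi> * ((p - m) / (2 * d)) + (- \<xi>) * ((p - 2 * v + m) / (2 * d)) = (- \<xi>) / d * (p - v)"
    for \<xi> p m d v :: real
    by (cases "d = 0"; simp add: field_simps)+
  show "- (grid_direction \<Delta>\<theta> \<Delta>\<phi> m n $ a) *
          ((u (i + axis a 1) m n - u (i - axis a 1) m n) / (2 * \<Delta>x $ a))
      + \<bar>grid_direction \<Delta>\<theta> \<Delta>\<phi> m n $ a\<bar> *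
          ((u (i + axis a 1) m n - 2 * u i m n + u (i - axis a 1) m n) / (2 * \<Delta>x $ a))
    = \<bar>grid_direction \<Delta>\<theta> \<Delta>\<phi> m n $ a\<bar> / \<Delta>x $ a *
      (u (if grid_direction \<Delta>\<theta> \<Delta>\<phi> m n $ a > 0 then i - axis a 1 else i + axis a 1) m n - u i m n)"
    by (simp only: abs_if pos neg split: if_splits) (auto simp: pos neg)
qed

text \<open>The mesh divides the box exactly, so an interior node is at least one cell away from
  each face and a single step cannot jump across. Only coordinate \<open>a\<close> moves, hence the
  neighbour never falls on an edge or a corner; and since the step goes against the direction, a
  face that it hits is an inflow face.\<close>

lemma upwind_neighbour_in_grid:
  assumes L: "\<And>a. L $ a > 0" and M: "\<And>a. M $ a > 0"
    and \<Delta>x: "\<And>a. \<Delta>x $ a = L $ a / real (M $ a)"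
    and grid: "(i, m, n) \<in> grid_in \<Delta>x \<Delta>\<theta> \<Delta>\<phi> (phase_space L)"
    and \<xi>: "grid_direction \<Delta>\<theta> \<Delta>\<phi> m n $ a \<noteq> 0"
  shows "(upwind_neighbour \<Delta>\<theta> \<Delta>\<phi> i m n a, m, n) \<in> grid_in \<Delta>x \<Delta>\<theta> \<Delta>\<phi> (phase_space L \<union> inflow_boundary L)"
proof -
  define \<xi> where "\<xi> = grid_direction \<Delta>\<theta> \<Delta>\<phi> m n"
  define y where "y = grid_point \<Delta>x (upwind_neighbour \<Delta>\<theta> \<Delta>\<phi> i m n a)"
  have dx: "\<Delta>x $ b > 0" "real (M $ b) * \<Delta>x $ b = L $ b" for b
    using L[of b] M[of b] \<Delta>x[of b] by auto
  have interior: "0 < real_of_int (i $ b) * \<Delta>x $ b" "real_of_int (i $ b) * \<Delta>x $ b < L $ b" for b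
    using grid by (auto simp: grid_in_def phase_space_def mem_box_cart grid_point_def)
  have i: "1 \<le> i $ b" "i $ b + 1 \<le> int (M $ b)" for b
  proof -
    show "1 \<le> i $ b" using interior(1)[of b] dx(1)[of b] by (simp add: zero_less_mult_iff)
    have "real_of_int (i $ b) * \<Delta>x $ b < real (M $ b) * \<Delta>x $ b" using interior(2)[of b] dx(2)[of b] by simp
    then have "real_of_int (i $ b) < real (M $ b)" using dx(1)[of b] by simp
    then show "i $ b + 1 \<le> int (M $ b)" by linarith
  qed
  have other: "y $ b = real_of_int (i $ b) * \<Delta>x $ b" if "b \<noteq> a" for b
    using that by (simp add: y_def upwind_neighbour_def grid_point_def axis_def)
  have bounds: "0 \<le> y $ b" "y $ b \<le> L $ b" for b
  proof -
    have "0 \<le> y $ a \<and> y $ a \<le> L $ a"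
    proof (cases "\<xi> $ a > 0")
      case True
      then have y: "y $ a = real_of_int (i $ a - 1) * \<Delta>x $ a"
        by (simp add: y_def upwind_neighbour_def grid_point_def axis_def \<xi>_def)
      have "y $ a \<le> real_of_int (i $ a) * \<Delta>x $ a"
        unfolding y using dx(1)[of a] by (intro mult_right_mono) auto
      moreover have "0 \<le> y $ a" unfolding y using i(1)[of a] dx(1)[of a] by simp
      ultimately show ?thesis using interior(2)[of a] by linarith
    next
      case False
      then have y: "y $ a = real_of_int (i $ a + 1) * \<Delta>x $ a"
        by (simp add: y_def upwind_neighbour_def grid_point_def axis_def \<xi>_def)
      have "real_of_int (i $ a + 1) \<le> real (M $ a)" using i(2)[of a] by linarith
      then have "y $ a \<le> real (M $ a) * \<Delta>x $ a"
        unfolding y using dx(1)[of a] by (intro mult_right_mono) auto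
      moreover have "0 \<le> y $ a" unfolding y using i(1)[of a] dx(1)[of a] by simp
      ultimately show ?thesis using dx(2)[of a] by simp
    qed
    then show "0 \<le> y $ b" "y $ b \<le> L $ b"
      using other[of b] interior[of b] by (cases "b = a"; simp)+
  qed
  have sphere: "\<xi> \<in> S2" by (simp add: \<xi>_def grid_direction_def norm_sph)
  have "(y, \<xi>) \<in> phase_space L \<union> inflow_boundary L"
  proof (cases "y \<in> box 0 L")
    case True
    then show ?thesis using sphere by (simp add: phase_space_def)
  next
    case False
    have face: "\<not> (0 < y $ a \<and> y $ a < L $ a)"
    proof
      assume "0 < y $ a \<and> y $ a < L $ a"
      then have "0 < y $ b \<and> y $ b < L $ b" for b
        using other[of b] interior[of b] by (cases "b = a") auto
      with False show False by (simp add: mem_box_cart)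
    qed
    have "closure (box 0 L) = cbox 0 L"
      by (rule closure_box) (use interior in \<open>auto simp: box_ne_empty Basis_vec_def inner_axis L less_imp_le\<close>)
    then have frontier: "y \<in> frontier (box 0 L)"
      using bounds False by (simp add: frontier_def interior_open[OF open_box] mem_box_cart)
    have "\<exists>\<eta>. outward_unit_normal L y \<eta> \<and> \<eta> \<bullet> \<xi> < 0"
    proof (cases "\<xi> $ a > 0")
      case True
      then have "y $ a = real_of_int (i $ a - 1) * \<Delta>x $ a"
        by (simp add: y_def upwind_neighbour_def grid_point_def axis_def \<xi>_def)
      also have "\<dots> < real_of_int (i $ a) * \<Delta>x $ a"
        using dx(1)[of a] by (intro mult_strict_right_mono) auto
      finally have "y $ a = 0" using face bounds(1)[of a] interior(2)[of a] by linarith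
      then have "outward_unit_normal L y (- axis a 1)"
        unfolding outward_unit_normal_def using other interior by (intro exI[of _ a]) auto
      moreover have "- axis a 1 \<bullet> \<xi> < 0" using True by (simp add: inner_axis')
      ultimately show ?thesis by blast
    next
      case False
      then have neg: "\<xi> $ a < 0" using \<xi> by (simp add: \<xi>_def)
      from False have "y $ a = real_of_int (i $ a + 1) * \<Delta>x $ a"
        by (simp add: y_def upwind_neighbour_def grid_point_def axis_def \<xi>_def)
      also have "\<dots> > real_of_int (i $ a) * \<Delta>x $ a"
        using dx(1)[of a] by (intro mult_strict_right_mono) auto
      finally have "y $ a = L $ a" using face bounds(2)[of a] interior(1)[of a] by linarith
      then have "outward_unit_normal L y (axis a 1)"
        unfolding outward_unit_normal_def using other interior by (intro exI[of _ a]) auto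
      moreover have "axis a 1 \<bullet> \<xi> < 0" using neg by (simp add: inner_axis')
      ultimately show ?thesis by blast
    qed
    then show ?thesis using frontier sphere by (simp add: inflow_boundary_def)
  qed
  then show ?thesis by (simp add: grid_in_def y_def \<xi>_def)
qed

section \<open>One implicit time step\<close>

text \<open>Detached from the grid, so that the maximum bound and the sign result can be read off
  the same identity. Extinction \<open>\<sigma>\<close> is the only implicit term, which puts it
  into the factor on the left.\<close>

lemma implicit_step_eq:
  fixes w v :: "'a \<Rightarrow> real" and u u' c \<tau> \<sigma> K q :: real
  assumes pos: "c > 0" "\<tau> > 0"
    and step: "1 / c * ((u' - u) / \<tau>) = (\<Sum>a\<in>S. w a * (v a - u)) - \<sigma> * u' + K + q"
  shows "(1 + c * \<tau> * \<sigma>) * u' =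
    (1 - (\<Sum>a\<in>S. c * \<tau> * w a)) * u + (\<Sum>a\<in>S. c * \<tau> * w a * v a) + c * \<tau> * K + c * \<tau> * q"
proof -
  have "u' - u = c * \<tau> * (1 / c * ((u' - u) / \<tau>))" using pos by simp
  also have "\<dots> = c * \<tau> * ((\<Sum>a\<in>S. w a * v a) - (\<Sum>a\<in>S. w a) * u - \<sigma> * u' + K + q)"
    unfolding step by (simp add: right_diff_distrib sum_subtractf sum_distrib_right)
  finally show ?thesis
    by (simp add: sum_distrib_left[symmetric] mult.assoc algebra_simps)
qed

text \<open>The coefficients of \<open>N\<close> add up to
  \<open>(1 - ?\<Lambda>) + ?\<Lambda> + c * \<tau> * \<sigma>\<close>, exactly the factor on the
  left, so division returns \<open>N\<close> and can only shrink the source. Neighbours of zero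
  weight are exempt from the bound because they may lie outside the grid.\<close>

lemma implicit_step_bound:
  fixes w v :: "'a \<Rightarrow> real" and u u' c \<tau> \<sigma> K q :: real
  assumes pos: "c > 0" "\<tau> > 0" "\<sigma> \<ge> 0"
    and step: "1 / c * ((u' - u) / \<tau>) = (\<Sum>a\<in>S. w a * (v a - u)) - \<sigma> * u' + K + q"
    and w: "\<And>a. a \<in> S \<Longrightarrow> 0 \<le> w a" and CFL: "(\<Sum>a\<in>S. c * \<tau> * w a) \<le> 1"
    and u: "\<bar>u\<bar> \<le> N" and v: "\<And>a. a \<in> S \<Longrightarrow> w a \<noteq> 0 \<Longrightarrow> \<bar>v a\<bar> \<le> N"
    and K: "\<bar>K\<bar> \<le> \<sigma> * N" and q: "\<bar>q\<bar> \<le> Q"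
  shows "\<bar>u'\<bar> \<le> N + c * \<tau> * Q"
proof -
  let ?\<Lambda> = "\<Sum>a\<in>S. c * \<tau> * w a" and ?s = "c * \<tau> * \<sigma>"
  have ct: "0 < c * \<tau>" and s: "0 \<le> ?s" using pos by auto
  have Q: "0 \<le> Q" using q by linarith
  have b1: "\<bar>(1 - ?\<Lambda>) * u\<bar> \<le> (1 - ?\<Lambda>) * N"
    unfolding abs_mult using CFL u by (intro mult_mono) auto
  have "\<bar>\<Sum>a\<in>S. c * \<tau> * w a * v a\<bar> \<le> (\<Sum>a\<in>S. c * \<tau> * w a * N)"
  proof (rule order_trans[OF sum_abs sum_mono])
    fix a assume "a \<in> S"
    then show "\<bar>c * \<tau> * w a * v a\<bar> \<le> c * \<tau> * w a * N"
      using w[of a] v[of a] pos by (cases "w a = 0") (auto simp: abs_mult intro!: mult_left_mono)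
  qed
  then have b2: "\<bar>\<Sum>a\<in>S. c * \<tau> * w a * v a\<bar> \<le> ?\<Lambda> * N" by (simp only: sum_distrib_right)
  have b3: "\<bar>c * \<tau> * K\<bar> \<le> c * \<tau> * (\<sigma> * N)" "\<bar>c * \<tau> * q\<bar> \<le> c * \<tau> * Q"
    using K q ct by (simp_all only: abs_mult abs_of_pos[OF pos(1)] abs_of_pos[OF pos(2)] mult_le_cancel_left_pos)
  have "(1 + ?s) * \<bar>u'\<bar> = \<bar>(1 + ?s) * u'\<bar>" using s by (simp add: abs_mult)
  also have "\<dots> \<le> (1 - ?\<Lambda>) * N + ?\<Lambda> * N + c * \<tau> * (\<sigma> * N) + c * \<tau> * Q"
    unfolding implicit_step_eq[OF pos(1,2) step] using b1 b2 b3 by linarith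
  also have "\<dots> = (1 + ?s) * N + c * \<tau> * Q" by (simp add: algebra_simps)
  also have "\<dots> \<le> (1 + ?s) * (N + c * \<tau> * Q)"
    using s ct Q by (simp add: distrib_left distrib_right)
  finally show ?thesis using s by (simp add: mult_le_cancel_left_pos)
qed

lemma implicit_step_nonneg:
  fixes w v :: "'a \<Rightarrow> real" and u u' c \<tau> \<sigma> K q :: real
  assumes pos: "c > 0" "\<tau> > 0" "\<sigma> \<ge> 0"
    and step: "1 / c * ((u' - u) / \<tau>) = (\<Sum>a\<in>S. w a * (v a - u)) - \<sigma> * u' + K + q"
    and w: "\<And>a. a \<in> S \<Longrightarrow> 0 \<le> w a" and CFL: "(\<Sum>a\<in>S. c * \<tau> * w a) \<le> 1"
    and u: "0 \<le> u" and v: "\<And>a. a \<in> S \<Longrightarrow> w a \<noteq> 0 \<Longrightarrow> 0 \<le> v a"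
    and K: "0 \<le> K" and q: "0 \<le> q"
  shows "0 \<le> u'"
proof -
  have "0 \<le> c * \<tau> * w a * v a" if "a \<in> S" for a
    using w[OF that] v[OF that] pos by (cases "w a = 0") auto
  then have "0 \<le> (\<Sum>a\<in>S. c * \<tau> * w a * v a)" by (rule sum_nonneg)
  moreover have "0 \<le> (1 - (\<Sum>a\<in>S. c * \<tau> * w a)) * u" "0 \<le> c * \<tau> * K" "0 \<le> c * \<tau> * q"
    using CFL u K q pos by simp_all
  ultimately have "0 \<le> (1 + c * \<tau> * \<sigma>) * u'"
    unfolding implicit_step_eq[OF pos(1,2) step] by linarith
  moreover have "0 < 1 + c * \<tau> * \<sigma>" using pos by (simp add: add_pos_nonneg)
  ultimately show ?thesis by (simp add: zero_le_mult_iff)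
qed

theorem theorem5p1:
  fixes T :: real and L :: "real^3"
    and c \<mu>a \<mu>s :: "real^3 \<Rightarrow> real" and c_sup \<mu>_star :: real
    and pt :: "real^3 \<Rightarrow> real \<Rightarrow> real"
    and q I1 :: "real \<times> (real^3) \<times> (real^3) \<Rightarrow> real"
    and I0 :: "(real^3) \<times> (real^3) \<Rightarrow> real"
    and M :: "nat^3" and M\<theta> M\<phi> :: nat
    and \<Delta>t \<Delta>\<theta> \<Delta>\<phi> :: real and \<Delta>x :: "real^3"
    and I :: "nat \<Rightarrow> int^3 \<Rightarrow> int \<Rightarrow> int \<Rightarrow> real"
  assumes T: "T > 0" and L: "\<And>a. L $ a > 0"
    and meas_c: "c \<in> borel_measurable (lebesgue_on (box 0 L))"
    and meas_\<mu>a: "\<mu>a \<in> borel_measurable (lebesgue_on (box 0 L))"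
    and meas_\<mu>s: "\<mu>s \<in> borel_measurable (lebesgue_on (box 0 L))"
    and c_pos: "\<And>x. x \<in> box 0 L \<Longrightarrow> c x > 0"
    and \<mu>a_nonneg: "\<And>x. x \<in> box 0 L \<Longrightarrow> \<mu>a x \<ge> 0"
    and \<mu>s_nonneg: "\<And>x. x \<in> box 0 L \<Longrightarrow> \<mu>s x \<ge> 0"
    and \<mu>s_nonzero: "\<exists>x\<in>box 0 L. \<mu>s x \<noteq> 0"
    and c_bdd: "bdd_above (c ` box 0 L)"
    and c_sup: "c_sup = (SUP x\<in>box 0 L. c x)"
    and \<mu>_star: "\<mu>_star = (INF x\<in>{x \<in> box 0 L. \<mu>s x \<noteq> 0}. \<mu>a x / \<mu>s x)"
    and \<mu>_star_pos: "\<mu>_star > 0"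
    and pt_nonneg: "\<And>x \<alpha>. x \<in> box 0 L \<Longrightarrow> pt x \<alpha> \<ge> 0"
    and pt_periodic: "\<And>x \<alpha>. x \<in> box 0 L \<Longrightarrow> pt x (\<alpha> + 2 * pi) = pt x \<alpha>"
    and pt_even: "\<And>x \<alpha>. x \<in> box 0 L \<Longrightarrow> pt x (- \<alpha>) = pt x \<alpha>"
    and pt_C2: "\<And>x. x \<in> box 0 L \<Longrightarrow> C2_function (pt x)"
    and pt_normalized: "\<And>x. x \<in> box 0 L \<Longrightarrow> 2 * pi * integral {0..pi} (\<lambda>\<alpha>. pt x \<alpha> * sin \<alpha>) = 1"
    and pt_dd_bounded: "sup_norm (box 0 L \<times> {0..2*pi}) (\<lambda>(x, \<alpha>). (deriv ^^ 2) (pt x) \<alpha>) < \<infinity>"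
    and q_meas: "measurable_source T L q" and q_bounded: "bounded (q ` ({0..T} \<times> phase_space L))"
    and I0_meas: "measurable_initial L I0" and I0_bounded: "bounded (I0 ` phase_space L)"
    and I1_meas: "measurable_inflow T L I1" and I1_bounded: "bounded (I1 ` ({0..T} \<times> inflow_boundary L))"
    and M: "\<And>a. M $ a > 0" and M\<theta>: "M\<theta> > 0" and M\<phi>: "M\<phi> > 0" and \<Delta>t: "\<Delta>t > 0"
    and \<Delta>x: "\<And>a. \<Delta>x $ a = L $ a / real (M $ a)"
    and \<Delta>\<theta>: "\<Delta>\<theta> = pi / real M\<theta>" and \<Delta>\<phi>: "\<Delta>\<phi> = 2 * pi / real M\<phi>"
    and scheme: "\<And>k i m n. real k \<le> T / \<Delta>t - 1 \<Longrightarrow> (i, m, n) \<in> grid_in \<Delta>x \<Delta>\<theta> \<Delta>\<phi> (phase_space L) \<Longrightarrow>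
      1 / c (grid_point \<Delta>x i) * ((I (Suc k) i m n - I k i m n) / \<Delta>t) =
        A_\<Delta> \<Delta>x \<Delta>\<theta> \<Delta>\<phi> (I k) i m n - \<Sigma>_\<Delta> \<Delta>x \<mu>a \<mu>s (I (Suc k)) i m n
        + K_\<Delta> \<Delta>x M\<theta> M\<phi> \<Delta>\<theta> \<Delta>\<phi> \<mu>s pt (I k) i m n
        + q (real k * \<Delta>t, grid_point \<Delta>x i, grid_direction \<Delta>\<theta> \<Delta>\<phi> m n)"
    and initial: "\<And>i m n. (i, m, n) \<in> grid_in \<Delta>x \<Delta>\<theta> \<Delta>\<phi> (phase_space L) \<Longrightarrow>
      I 0 i m n = I0 (grid_point \<Delta>x i, grid_direction \<Delta>\<theta> \<Delta>\<phi> m n)"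
    and inflow: "\<And>k i m n. real k \<le> T / \<Delta>t \<Longrightarrow> (i, m, n) \<in> grid_in \<Delta>x \<Delta>\<theta> \<Delta>\<phi> (inflow_boundary L) \<Longrightarrow>
      I k i m n = I1 (real k * \<Delta>t, grid_point \<Delta>x i, grid_direction \<Delta>\<theta> \<Delta>\<phi> m n)"
    and CFL: "c_sup * \<Delta>t / \<Delta>x $ 1 + c_sup * \<Delta>t / \<Delta>x $ 2 + c_sup * \<Delta>t / \<Delta>x $ 3 \<le> 1"
    and angular: "ennreal (\<Delta>\<theta>\<^sup>2) * sup_dtheta2 L pt + ennreal (\<Delta>\<phi>\<^sup>2 / 2) * sup_dphi2 L pt
      \<le> ennreal (6 / pi\<^sup>2 * \<mu>_star)"
  shows "(\<forall>k. real k \<le> T / \<Delta>t \<longrightarrow>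
      sup_norm (grid_in \<Delta>x \<Delta>\<theta> \<Delta>\<phi> (phase_space L \<union> inflow_boundary L)) (\<lambda>(i, m, n). I k i m n)
        \<le> sup_norm (phase_space L) I0 + sup_norm ({0..T} \<times> inflow_boundary L) I1
          + ennreal c_sup * sup_norm ({0..T} \<times> phase_space L) q * ennreal T)
    \<and> ((\<forall>z\<in>{0..T} \<times> phase_space L. q z \<ge> 0) \<and> (\<forall>z\<in>phase_space L. I0 z \<ge> 0)
        \<and> (\<forall>z\<in>{0..T} \<times> inflow_boundary L. I1 z \<ge> 0) \<longrightarrow>
      (\<forall>k i m n. real k \<le> T / \<Delta>t \<and>
          (i, m, n) \<in> grid_in \<Delta>x \<Delta>\<theta> \<Delta>\<phi> (phase_space L \<union> inflow_boundary L) \<longrightarrow> I k i m n \<ge> 0))"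
proof -
  let ?X = "grid_in \<Delta>x \<Delta>\<theta> \<Delta>\<phi> (phase_space L)"
    and ?U = "grid_in \<Delta>x \<Delta>\<theta> \<Delta>\<phi> (phase_space L \<union> inflow_boundary L)"
  let ?W = "\<lambda>i m n \<mu> \<nu>. scattering_kernel pt (grid_point \<Delta>x i)
    (grid_direction \<Delta>\<theta> \<Delta>\<phi> m n) (grid_direction \<Delta>\<theta> \<Delta>\<phi> \<mu> \<nu>) * sin (real_of_int \<mu> * \<Delta>\<theta>)"
  let ?w = "\<lambda>m n a. \<bar>grid_direction \<Delta>\<theta> \<Delta>\<phi> m n $ a\<bar> / \<Delta>x $ a"
  let ?\<sigma> = "\<lambda>i. \<mu>s (grid_point \<Delta>x i) + \<mu>a (grid_point \<Delta>x i)"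
  have dx: "\<Delta>x $ a > 0" for a using L[of a] M[of a] \<Delta>x[of a] by simp
  have \<Delta>\<theta>_pos: "\<Delta>\<theta> > 0" and \<Delta>\<phi>_pos: "\<Delta>\<phi> > 0" using \<Delta>\<theta> \<Delta>\<phi> M\<theta> M\<phi> by auto
  have X_box: "grid_point \<Delta>x i \<in> box 0 L" if "(i, m, n) \<in> ?X" for i m n
    using that by (simp add: grid_in_def phase_space_def)
  \<comment> \<open>Being an interior point does not depend on the direction, so every unknown in
    the scattering sum at such a point is covered by the induction hypothesis.\<close>
  have X_direction: "(i, \<mu>, \<nu>) \<in> ?U" if "(i, m, n) \<in> ?X" for i m n \<mu> \<nu>
    using that by (simp add: grid_in_def phase_space_def grid_direction_def norm_sph)
  have X_U: "?X \<subseteq> ?U" by (auto simp: grid_in_def)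
  have U_cases: "(i, m, n) \<in> ?X \<or> (i, m, n) \<in> grid_in \<Delta>x \<Delta>\<theta> \<Delta>\<phi> (inflow_boundary L)"
    if "(i, m, n) \<in> ?U" for i m n
    using that by (auto simp: grid_in_def)
  have c_le: "c x \<le> c_sup" if "x \<in> box 0 L" for x
    unfolding c_sup using that c_bdd by (rule cSUP_upper)
  have c_sup_pos: "c_sup > 0"
    using \<mu>s_nonzero c_pos c_le less_le_trans by blast
  \<comment> \<open>Where \<open>\<mu>s\<close> vanishes the infimum says nothing, and the claim
    reduces to \<open>\<mu>a \<ge> 0\<close>.\<close>
  have \<mu>_star_le: "\<mu>s x * \<mu>_star \<le> \<mu>a x" if x: "x \<in> box 0 L" for x
  proof (cases "\<mu>s x = 0")
    case False
    have "bdd_below ((\<lambda>x. \<mu>a x / \<mu>s x) ` {x \<in> box 0 L. \<mu>s x \<noteq> 0})"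
      using \<mu>a_nonneg \<mu>s_nonneg by (intro bdd_belowI2[of _ 0]) auto
    then have "\<mu>_star \<le> \<mu>a x / \<mu>s x" unfolding \<mu>_star by (rule cINF_lower) (use x False in simp)
    then show ?thesis using False \<mu>s_nonneg[OF x] by (simp add: field_simps)
  qed (use \<mu>a_nonneg x in simp)
  have \<sigma>_nonneg: "0 \<le> ?\<sigma> i" if "(i, m, n) \<in> ?X" for i m n
    using X_box[OF that] \<mu>a_nonneg \<mu>s_nonneg by (simp add: add_nonneg_nonneg)
  have w_nonneg: "0 \<le> ?w m n a" for m n a using dx[of a] by simp
  have CFL': "(\<Sum>a\<in>UNIV. c (grid_point \<Delta>x i) * \<Delta>t * ?w m n a) \<le> 1" if "(i, m, n) \<in> ?X" for i m n
  proof -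
    have "(\<Sum>a\<in>UNIV. c (grid_point \<Delta>x i) * \<Delta>t * ?w m n a) \<le> (\<Sum>a\<in>UNIV. c_sup * \<Delta>t / \<Delta>x $ a)"
    proof (rule sum_mono)
      fix a
      have "\<bar>grid_direction \<Delta>\<theta> \<Delta>\<phi> m n $ a\<bar> \<le> 1"
        using component_le_norm_cart[of "grid_direction \<Delta>\<theta> \<Delta>\<phi> m n" a]
        by (simp add: grid_direction_def norm_sph)
      then have "c (grid_point \<Delta>x i) * \<Delta>t * ?w m n a \<le> c_sup * \<Delta>t * (1 / \<Delta>x $ a)"
        using c_le[OF X_box[OF that]] c_sup_pos \<Delta>t dx[of a]
        by (intro mult_mono divide_right_mono) auto
      then show "c (grid_point \<Delta>x i) * \<Delta>t * ?w m n a \<le> c_sup * \<Delta>t / \<Delta>x $ a" by simp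
    qed
    then show ?thesis using CFL by (simp add: sum_3)
  qed
  have W_nonneg: "0 \<le> ?W i m n \<mu> \<nu>" if "(i, m, n) \<in> ?X" "\<mu> \<in> {1..int M\<theta> - 1}" for i m n \<mu> \<nu>
  proof -
    have "real_of_int \<mu> \<le> real M\<theta>" using that(2) by auto
    then have "real_of_int \<mu> * \<Delta>\<theta> \<le> real M\<theta> * \<Delta>\<theta>" using \<Delta>\<theta>_pos by (intro mult_right_mono) auto
    then have "0 \<le> sin (real_of_int \<mu> * \<Delta>\<theta>)"
      using that(2) \<Delta>\<theta>_pos M\<theta> \<Delta>\<theta> by (intro sin_ge_zero) auto
    then show ?thesis
      using pt_nonneg[OF X_box[OF that(1)]] by (simp add: scattering_kernel_def)
  qed
  have W_sum: "\<Delta>\<theta> * \<Delta>\<phi> * (\<Sum>\<mu>\<in>{1..int M\<theta> - 1}. \<Sum>\<nu>\<in>{0..int M\<phi> - 1}. ?W i m n \<mu> \<nu>) \<le> 1 + \<mu>_star"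
    if "(i, m, n) \<in> ?X" for i m n
    using kernel_quadrature_le[OF X_box[OF that] pt_periodic pt_even pt_C2 pt_normalized
        M\<theta> M\<phi> \<Delta>\<theta> \<Delta>\<phi> less_imp_le[OF \<mu>_star_pos] angular, OF X_box[OF that] X_box[OF that]
        X_box[OF that] X_box[OF that], of "real_of_int m * \<Delta>\<theta>" "real_of_int n * \<Delta>\<phi>"]
    by (simp add: grid_direction_def)
  have K_bound: "\<bar>K_\<Delta> \<Delta>x M\<theta> M\<phi> \<Delta>\<theta> \<Delta>\<phi> \<mu>s pt u i m n\<bar> \<le> ?\<sigma> i * N"
    if X: "(i, m, n) \<in> ?X" and u: "\<And>\<mu> \<nu>. \<bar>u i \<mu> \<nu>\<bar> \<le> N" for u i m n N
  proof -
    let ?S = "\<Sum>\<mu>\<in>{1..int M\<theta> - 1}. \<Sum>\<nu>\<in>{0..int M\<phi> - 1}. ?W i m n \<mu> \<nu> * u i \<mu> \<nu>"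
    let ?T = "\<Sum>\<mu>\<in>{1..int M\<theta> - 1}. \<Sum>\<nu>\<in>{0..int M\<phi> - 1}. ?W i m n \<mu> \<nu>"
    have N: "0 \<le> N" using u[of 0 0] by linarith
    have \<mu>s: "0 \<le> \<mu>s (grid_point \<Delta>x i)" using \<mu>s_nonneg X_box[OF X] by blast
    have "\<bar>?S\<bar> \<le> (\<Sum>\<mu>\<in>{1..int M\<theta> - 1}. \<Sum>\<nu>\<in>{0..int M\<phi> - 1}. ?W i m n \<mu> \<nu> * N)"
    proof (rule order_trans[OF sum_abs sum_mono], rule order_trans[OF sum_abs sum_mono])
      fix \<mu> \<nu> assume \<mu>: "\<mu> \<in> {1..int M\<theta> - 1}"
      show "\<bar>?W i m n \<mu> \<nu> * u i \<mu> \<nu>\<bar> \<le> ?W i m n \<mu> \<nu> * N"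
        unfolding abs_mult[of "?W i m n \<mu> \<nu>"] abs_of_nonneg[OF W_nonneg[OF X \<mu>]]
        by (rule mult_left_mono[OF u W_nonneg[OF X \<mu>]])
    qed
    also have "\<dots> = ?T * N" by (simp only: sum_distrib_right)
    finally have S: "\<bar>?S\<bar> \<le> ?T * N" .
    have "\<bar>K_\<Delta> \<Delta>x M\<theta> M\<phi> \<Delta>\<theta> \<Delta>\<phi> \<mu>s pt u i m n\<bar> = \<mu>s (grid_point \<Delta>x i) * (\<Delta>\<theta> * \<Delta>\<phi> * \<bar>?S\<bar>)"
      using \<mu>s \<Delta>\<theta>_pos \<Delta>\<phi>_pos by (simp add: K_\<Delta>_def abs_mult)
    also have "\<dots> \<le> \<mu>s (grid_point \<Delta>x i) * (\<Delta>\<theta> * \<Delta>\<phi> * (?T * N))"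
      using \<mu>s \<Delta>\<theta>_pos \<Delta>\<phi>_pos S by (intro mult_left_mono) auto
    also have "\<dots> = \<mu>s (grid_point \<Delta>x i) * (\<Delta>\<theta> * \<Delta>\<phi> * ?T) * N" by (simp only: mult.assoc)
    also have "\<dots> \<le> \<mu>s (grid_point \<Delta>x i) * (1 + \<mu>_star) * N"
      using \<mu>s N W_sum[OF X] by (intro mult_left_mono mult_right_mono) auto
    also have "\<dots> \<le> ?\<sigma> i * N"
      using \<mu>_star_le[OF X_box[OF X]] N by (intro mult_right_mono) (simp_all add: distrib_left)
    finally show ?thesis .
  qed
  have K_nonneg: "0 \<le> K_\<Delta> \<Delta>x M\<theta> M\<phi> \<Delta>\<theta> \<Delta>\<phi> \<mu>s pt u i m n"
    if X: "(i, m, n) \<in> ?X" and u: "\<And>\<mu> \<nu>. 0 \<le> u i \<mu> \<nu>" for u i m n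
    unfolding K_\<Delta>_def using \<mu>s_nonneg[OF X_box[OF X]] \<Delta>\<theta>_pos \<Delta>\<phi>_pos W_nonneg[OF X] u
    by (intro mult_nonneg_nonneg[of "\<mu>s _ * _ * _"] sum_nonneg mult_nonneg_nonneg[OF _ u]) auto
  have step: "1 / c (grid_point \<Delta>x i) * ((I (Suc k) i m n - I k i m n) / \<Delta>t) =
      (\<Sum>a\<in>UNIV. ?w m n a * (I k (upwind_neighbour \<Delta>\<theta> \<Delta>\<phi> i m n a) m n - I k i m n))
      - ?\<sigma> i * I (Suc k) i m n + K_\<Delta> \<Delta>x M\<theta> M\<phi> \<Delta>\<theta> \<Delta>\<phi> \<mu>s pt (I k) i m n
      + q (real k * \<Delta>t, grid_point \<Delta>x i, grid_direction \<Delta>\<theta> \<Delta>\<phi> m n)"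
    if "real (Suc k) \<le> T / \<Delta>t" "(i, m, n) \<in> ?X" for k i m n
    using scheme[of k i m n] that by (simp add: A_\<Delta>_upwind \<Sigma>_\<Delta>_def)
  have neighbour: "(upwind_neighbour \<Delta>\<theta> \<Delta>\<phi> i m n a, m, n) \<in> ?U"
    if "(i, m, n) \<in> ?X" "?w m n a \<noteq> 0" for i m n a
    using that by (intro upwind_neighbour_in_grid[OF L M \<Delta>x]) auto
  have time: "real k * \<Delta>t \<in> {0..T}" if "real k \<le> T / \<Delta>t" for k
    using that \<Delta>t by (simp add: field_simps)
  \<comment> \<open>Bounded data make the three norms finite, so the induction runs in real
    arithmetic and returns to \<open>ennreal\<close> only at the end.\<close>
  obtain n0 where n0: "0 \<le> n0" "sup_norm (phase_space L) I0 = ennreal n0"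
    using sup_norm_finiteE[OF I0_bounded] by blast
  obtain n1 where n1: "0 \<le> n1" "sup_norm ({0..T} \<times> inflow_boundary L) I1 = ennreal n1"
    using sup_norm_finiteE[OF I1_bounded] by blast
  obtain Q where Q: "0 \<le> Q" "sup_norm ({0..T} \<times> phase_space L) q = ennreal Q"
    using sup_norm_finiteE[OF q_bounded] by blast
  have I1_bound: "\<bar>I k i m n\<bar> \<le> n1"
    if "real k \<le> T / \<Delta>t" "(i, m, n) \<in> grid_in \<Delta>x \<Delta>\<theta> \<Delta>\<phi> (inflow_boundary L)" for k i m n
    unfolding inflow[OF that]
    by (rule sup_norm_bound[OF n1(2,1)]) (use time[OF that(1)] that(2) in \<open>simp add: grid_in_def\<close>)
  have q_bound: "\<bar>q (real k * \<Delta>t, grid_point \<Delta>x i, grid_direction \<Delta>\<theta> \<Delta>\<phi> m n)\<bar> \<le> Q"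
    if "real k \<le> T / \<Delta>t" "(i, m, n) \<in> ?X" for k i m n
    by (rule sup_norm_bound[OF Q(2,1)]) (use time[OF that(1)] that(2) in \<open>simp add: grid_in_def\<close>)
  \<comment> \<open>The sum \<open>n0 + n1\<close> dominates both initial and inflow data, so inflow
    nodes at any level are bounded without the induction hypothesis. The last summand grows by one
    source contribution per step.\<close>
  have stable: "\<bar>I k i m n\<bar> \<le> n0 + n1 + real k * \<Delta>t * (c_sup * Q)"
    if "real k \<le> T / \<Delta>t" "(i, m, n) \<in> ?U" for k i m n
    using that
  proof (induction k arbitrary: i m n)
    case 0
    show ?case
    proof (cases "(i, m, n) \<in> ?X")
      case True
      then have "\<bar>I 0 i m n\<bar> \<le> n0"
        unfolding initial[OF True] by (intro sup_norm_bound[OF n0(2,1)]) (simp add: grid_in_def)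
      then show ?thesis using n1 by simp
    next
      case False
      then show ?thesis using I1_bound[OF 0(1)] U_cases[OF 0(2)] n0 by force
    qed
  next
    case (Suc k)
    have k: "real k \<le> T / \<Delta>t" using Suc.prems(1) by simp
    note IH = Suc.IH[OF k]
    let ?N = "n0 + n1 + real k * \<Delta>t * (c_sup * Q)"
    have mono: "?N + \<Delta>t * (c_sup * Q) = n0 + n1 + real (Suc k) * \<Delta>t * (c_sup * Q)"
      by (simp add: algebra_simps)
    have nonneg: "0 \<le> real (Suc k) * \<Delta>t * (c_sup * Q)" using \<Delta>t c_sup_pos Q by simp
    show ?case
    proof (cases "(i, m, n) \<in> ?X")
      case True
      note box = X_box[OF True]
      have "\<bar>I (Suc k) i m n\<bar> \<le> ?N + c (grid_point \<Delta>x i) * \<Delta>t * Q"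
      proof (rule implicit_step_bound[OF c_pos[OF box] \<Delta>t \<sigma>_nonneg[OF True] step[OF Suc.prems(1) True]
            w_nonneg CFL'[OF True]])
        show "\<bar>I k i m n\<bar> \<le> ?N" using IH X_U True by blast
        show "\<bar>I k (upwind_neighbour \<Delta>\<theta> \<Delta>\<phi> i m n a) m n\<bar> \<le> ?N" if "?w m n a \<noteq> 0" for a
          using IH neighbour[OF True that] by blast
        show "\<bar>K_\<Delta> \<Delta>x M\<theta> M\<phi> \<Delta>\<theta> \<Delta>\<phi> \<mu>s pt (I k) i m n\<bar> \<le> ?\<sigma> i * ?N"
          by (intro K_bound[OF True] IH X_direction[OF True])
        show "\<bar>q (real k * \<Delta>t, grid_point \<Delta>x i, grid_direction \<Delta>\<theta> \<Delta>\<phi> m n)\<bar> \<le> Q"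
          by (rule q_bound[OF k True])
      qed
      also have "\<dots> \<le> ?N + c_sup * \<Delta>t * Q"
        using c_le[OF box] \<Delta>t Q by (intro add_left_mono mult_right_mono) auto
      finally show ?thesis using mono by (simp add: mult.commute mult.left_commute)
    next
      case False
      then have "\<bar>I (Suc k) i m n\<bar> \<le> n1" using I1_bound[OF Suc.prems(1)] U_cases[OF Suc.prems(2)] by blast
      then show ?thesis using n0 nonneg by linarith
    qed
  qed
  have "sup_norm ?U (\<lambda>(i, m, n). I k i m n)
      \<le> sup_norm (phase_space L) I0 + sup_norm ({0..T} \<times> inflow_boundary L) I1
        + ennreal c_sup * sup_norm ({0..T} \<times> phase_space L) q * ennreal T" if k: "real k \<le> T / \<Delta>t" for k
  proof -
    have "real k * \<Delta>t * (c_sup * Q) \<le> T * (c_sup * Q)"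
      using time[OF k] c_sup_pos Q by (intro mult_right_mono) auto
    then have "sup_norm ?U (\<lambda>(i, m, n). I k i m n) \<le> ennreal (n0 + n1 + c_sup * Q * T)"
      using stable[OF k] by (intro sup_norm_le) (force simp: mult.commute intro: order_trans)
    also have "\<dots> = ennreal n0 + ennreal n1 + ennreal c_sup * ennreal Q * ennreal T"
      using n0 n1 Q T c_sup_pos by (simp add: ennreal_plus ennreal_mult)
    finally show ?thesis unfolding n0 n1 Q .
  qed
  moreover have "0 \<le> I k i m n"
    if q: "\<forall>z\<in>{0..T} \<times> phase_space L. q z \<ge> 0" and I0: "\<forall>z\<in>phase_space L. I0 z \<ge> 0"
      and I1: "\<forall>z\<in>{0..T} \<times> inflow_boundary L. I1 z \<ge> 0"
      and k: "real k \<le> T / \<Delta>t" and U: "(i, m, n) \<in> ?U" for k i m n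
    using k U
  proof (induction k arbitrary: i m n)
    case 0
    show ?case
    proof (cases "(i, m, n) \<in> ?X")
      case True
      then show ?thesis unfolding initial[OF True] using I0 by (auto simp: grid_in_def)
    next
      case False
      then have B: "(i, m, n) \<in> grid_in \<Delta>x \<Delta>\<theta> \<Delta>\<phi> (inflow_boundary L)" using U_cases[OF 0(2)] by blast
      show ?thesis unfolding inflow[OF 0(1) B] using I1 B time[OF 0(1)] by (auto simp: grid_in_def)
    qed
  next
    case (Suc k)
    have k: "real k \<le> T / \<Delta>t" using Suc.prems(1) by simp
    note IH = Suc.IH[OF k]
    show ?case
    proof (cases "(i, m, n) \<in> ?X")
      case True
      show ?thesis
      proof (rule implicit_step_nonneg[OF c_pos[OF X_box[OF True]] \<Delta>t \<sigma>_nonneg[OF True]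
            step[OF Suc.prems(1) True] w_nonneg CFL'[OF True]])
        show "0 \<le> I k i m n" using IH X_U True by blast
        show "0 \<le> I k (upwind_neighbour \<Delta>\<theta> \<Delta>\<phi> i m n a) m n" if "?w m n a \<noteq> 0" for a
          using IH neighbour[OF True that] by blast
        show "0 \<le> K_\<Delta> \<Delta>x M\<theta> M\<phi> \<Delta>\<theta> \<Delta>\<phi> \<mu>s pt (I k) i m n"
          by (intro K_nonneg[OF True] IH X_direction[OF True])
        show "0 \<le> q (real k * \<Delta>t, grid_point \<Delta>x i, grid_direction \<Delta>\<theta> \<Delta>\<phi> m n)"
          using q time[OF k] True by (auto simp: grid_in_def)
      qed
    next
      case False
      then have B: "(i, m, n) \<in> grid_in \<Delta>x \<Delta>\<theta> \<Delta>\<phi> (inflow_boundary L)"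
        using U_cases[OF Suc.prems(2)] by blast
      show ?thesis
        unfolding inflow[OF Suc.prems(1) B]
        using I1 B time[OF Suc.prems(1)] by (auto simp: grid_in_def)
    qed
  qed
  ultimately show ?thesis by blast
qed

end
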